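(* Let $s\in(0,1)$ and let $u\in \mathscr S(\mathbb R^{N+1})$. Then, for every $(X,t)\in \mathbb R^{N+1}$ we have $$(-\mathscr{K})^{s}(u^{2})(X,t) = 2u(X,t)(-\mathscr{K})^{s} u(X,t)-2\Gamma^{\mathscr K}_{(s)}(u)(X,t).$$ In particular, $$(-\mathscr{K})^{s}(u^{2})(X,t) \le 2u(X,t)(-\mathscr{K})^{s} u(X,t).$$ More in general, for every convex function $\varphi\in C^1(\mathbb R)$ and every $(X,t)\in\mathbb R^{N+1}$, one has $$(-\mathscr{K})^{s} (\varphi\circ u)(X,t) \le \varphi'(u(X,t))\,(-\mathscr{K})^{s} u(X,t).$$
   Context: $N\ge 2$; points of $\mathbb R^{N+1}$ are written $(X,t)$ with $X\in\mathbb R^N$, $t\in\mathbb R$, and $\mathscr S(\mathbb R^{N+1})$ is the Schwartz space (real-valued functions). Let $Q,B$ be real constant $N\times N$ matrices with $Q=Q^\star\ge 0$, and $$\mathscr K u = \operatorname{tr}(Q \nabla^2 u) + \langle BX,\nabla u\rangle - \partial_t u ,\qquad K(t) = \frac 1t \int_0^t e^{\sigma B} Q e^{\sigma B^\star} d\sigma ,$$ where $\nabla,\nabla^2$ are taken in $X$. It is assumed that $K(t)$ is invertible (i.e. strictly positive) for every $t>0$. Let $$p(X,Y,t) = (4\pi)^{- \frac N2} \left(\det(t K(t))\right)^{-1/2} \exp\left( - \frac{\langle K(t)^{-1}(Y-e^{tB} X ),Y-e^{tB} X \rangle}{4t}\right)$$ for $X,Y\in\mathbb R^N$, $t>0$,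 and $$P_\tau^{\mathscr K} u(X,t) = \int_{\mathbb R^N} p(X,Y,\tau)\, u(Y,t-\tau)\, dY,\qquad \tau>0.$$ For $s\in(0,1)$ define $$(-\mathscr K)^s w(X,t) = - \frac{s}{\Gamma(1-s)} \int_0^\infty \tau^{-1-s} \left[P^{\mathscr K}_\tau w(X,t)- w(X,t)\right] d\tau ,$$ where $\Gamma(\cdot)$ with a numerical argument is the Euler gamma function. This formula is used both for $w=u$ and for $w=\varphi\circ u$; for $w=\varphi\circ u$ with $\varphi$ convex and only $C^1$, the value is understood in $[-\infty,\infty)$. The nonlocal evolutive carré du champ of $u:\mathbb R^{N+1}\to\mathbb R$ is $$\Gamma^{\mathscr K}_{(s)}(u)(X,t) = \frac{s}{2\Gamma(1-s)}\int_0^\infty \frac{1}{\tau^{1+s}}\, P^{\mathscr K}_\tau\big((u - u(X,t))^2\big)(X,t)\, d\tau,$$ where $P^{\mathscr K}_\tau((u - u(X,t))^2)(X,t)=\int_{\mathbb R^N}p(X,Y,\tau)\,(u(Y,t-\tau)-u(X,t))^2\,dY$. *)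

theory Defs
  imports "HOL-Analysis.Analysis"
begin

text \<open>
  Schwartz functions. \<open>iter_partial [b\<^sub>1, \<dots>, b\<^sub>k] f\<close> is the iterated directional derivative of \<open>f\<close>
  along \<open>b\<^sub>k\<close> first and \<open>b\<^sub>1\<close> last; with all \<open>b\<^sub>i\<close> in \<^term>\<open>Basis\<close> these are the partial derivatives
  of order \<open>k\<close>. If all of them are (Frechet) differentiable everywhere, then \<open>f\<close> is smooth.
\<close>

primrec iter_partial :: "'a list \<Rightarrow> ('a::euclidean_space \<Rightarrow> real) \<Rightarrow> 'a \<Rightarrow> real" where
  "iter_partial [] f = f"
| "iter_partial (b # bs) f = (\<lambda>x. frechet_derivative (iter_partial bs f) (at x) b)"

definition smooth :: "('a::euclidean_space \<Rightarrow> real) \<Rightarrow> bool" where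
  "smooth f \<longleftrightarrow> (\<forall>bs. set bs \<subseteq> Basis \<longrightarrow> iter_partial bs f differentiable_on UNIV)"

definition schwartz :: "('a::euclidean_space \<Rightarrow> real) set" where
  "schwartz = {f. smooth f \<and>
     (\<forall>m bs. set bs \<subseteq> Basis \<longrightarrow> (\<exists>C. \<forall>x. (1 + norm x) ^ m * \<bar>iter_partial bs f x\<bar> \<le> C))}"

text \<open>
  The library has no exponential on \<^typ>\<open>real^'n^'n\<close>: this type is not a normed algebra under
  the matrix product \<open>**\<close>.
\<close>

definition mat_exp :: "real^'n^'n \<Rightarrow> real^'n^'n" where
  "mat_exp A = (\<Sum>k. (1 / fact k) *\<^sub>R ((\<lambda>M. A ** M) ^^ k) (mat 1))"

definition covK :: "real^'n^'n \<Rightarrow> real^'n^'n \<Rightarrow> real \<Rightarrow> real^'n^'n" where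
  "covK Q B t =
     (1 / t) *\<^sub>R integral {0..t} (\<lambda>\<sigma>. mat_exp (\<sigma> *\<^sub>R B) ** Q ** mat_exp (\<sigma> *\<^sub>R transpose B))"

definition kernel :: "real^'n^'n \<Rightarrow> real^'n^'n \<Rightarrow> real^'n \<Rightarrow> real^'n \<Rightarrow> real \<Rightarrow> real" where
  "kernel Q B X Y t =
     (4 * pi) powr (- real CARD('n) / 2) * det (t *\<^sub>R covK Q B t) powr (- 1 / 2) *
     exp (- ((matrix_inv (covK Q B t) *v (Y - mat_exp (t *\<^sub>R B) *v X)) \<bullet>
             (Y - mat_exp (t *\<^sub>R B) *v X)) / (4 * t))"

definition evol_semigroup ::
  "real^'n^'n \<Rightarrow> real^'n^'n \<Rightarrow> real \<Rightarrow> ((real^'n) \<times> real \<Rightarrow> real) \<Rightarrow> (real^'n) \<times> real \<Rightarrow> real" where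
  "evol_semigroup Q B \<tau> w = (\<lambda>(X, t). LINT Y|lborel. kernel Q B X Y \<tau> * w (Y, t - \<tau>))"

text \<open>
  Lebesgue integral over \<open>A\<close> with values in the extended reals: the integral of the positive part
  minus that of the negative part (\<^const>\<open>ennreal\<close> maps negative reals to \<open>0\<close>). It is finite iff
  both are. It is written as a negated difference because \<open>\<infinity> - \<infinity> = \<infinity>\<close> in \<^typ>\<open>ereal\<close>: the
  undefined case then has value \<open>-\<infinity>\<close>, and \<open>ext_integral A f > -\<infinity>\<close> holds iff the negative part
  has finite integral.
\<close>

definition ext_integral :: "real set \<Rightarrow> (real \<Rightarrow> real) \<Rightarrow> ereal" where
  "ext_integral A f =
     - (enn2ereal (\<integral>\<^sup>+x\<in>A. ennreal (- f x) \<partial>lborel) - enn2ereal (\<integral>\<^sup>+x\<in>A. ennreal (f x) \<partial>lborel))"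

lemma ext_integral_eq_set_lebesgue_integral:
  assumes "set_integrable lborel A f"
  shows "ext_integral A f = ereal (LINT x:A|lborel. f x)"
proof -
  have int: "integrable lborel (\<lambda>x. indicator A x * f x)"
    using assms by (simp add: set_integrable_def)
  have "(\<integral>\<^sup>+x\<in>A. ennreal (f x) \<partial>lborel) = (\<integral>\<^sup>+x. ennreal (indicator A x * f x) \<partial>lborel)"
    and "(\<integral>\<^sup>+x\<in>A. ennreal (- f x) \<partial>lborel) = (\<integral>\<^sup>+x. ennreal (- (indicator A x * f x)) \<partial>lborel)"
    by (auto intro!: nn_integral_cong simp: indicator_def)
  moreover from int obtain r q where "0 \<le> r" "0 \<le> q"
    "(\<integral>\<^sup>+x. ennreal (indicator A x * f x) \<partial>lborel) = ennreal r"
    "(\<integral>\<^sup>+x. ennreal (- (indicator A x * f x)) \<partial>lborel) = ennreal q"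
    "integral\<^sup>L lborel (\<lambda>x. indicator A x * f x) = r - q"
    by (rule integrableE)
  ultimately show ?thesis
    by (simp add: ext_integral_def set_lebesgue_integral_def enn2ereal_ennreal)
qed

lemma ext_integral_gt_minus_infinity_iff:
  "ext_integral A f > - \<infinity> \<longleftrightarrow> (\<integral>\<^sup>+x\<in>A. ennreal (- f x) \<partial>lborel) < \<infinity>"
  unfolding ext_integral_def
  by (cases "\<integral>\<^sup>+x\<in>A. ennreal (- f x) \<partial>lborel"; cases "\<integral>\<^sup>+x\<in>A. ennreal (f x) \<partial>lborel")
     (auto simp: enn2ereal_ennreal)

definition frac_power ::
  "real^'n^'n \<Rightarrow> real^'n^'n \<Rightarrow> real \<Rightarrow> ((real^'n) \<times> real \<Rightarrow> real) \<Rightarrow> (real^'n) \<times> real \<Rightarrow> ereal" where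
  "frac_power Q B s w z =
     ereal (- (s / Gamma (1 - s))) *
     ext_integral {0<..} (\<lambda>\<tau>. \<tau> powr (- 1 - s) * (evol_semigroup Q B \<tau> w z - w z))"

definition carre_du_champ ::
  "real^'n^'n \<Rightarrow> real^'n^'n \<Rightarrow> real \<Rightarrow> ((real^'n) \<times> real \<Rightarrow> real) \<Rightarrow> (real^'n) \<times> real \<Rightarrow> ereal" where
  "carre_du_champ Q B s u z =
     ereal (s / (2 * Gamma (1 - s))) *
     ext_integral {0<..}
       (\<lambda>\<tau>. 1 / \<tau> powr (1 + s) * evol_semigroup Q B \<tau> (\<lambda>z'. (u z' - u z)\<^sup>2) z)"

end

theory Submission
  imports "HOL-Probability.Distributions" Defs
begin

text \<open>
  Write \<open>u\<^sub>0 = u (X, t)\<close>. Since \<open>P\<^sub>\<tau> 1 = 1\<close>, integrating \<open>u\<^sup>2 - u\<^sub>0\<^sup>2 = 2 u\<^sub>0 (u - u\<^sub>0) + (u - u\<^sub>0)\<^sup>2\<close>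
  against the kernel and then against \<open>\<tau> powr (- 1 - s)\<close> gives the identity, and integrating the tangent
  inequality \<open>\<phi> \<circ> u - \<phi> u\<^sub>0 \<ge> \<phi>' u\<^sub>0 (u - u\<^sub>0)\<close> gives the convex case. The integrals
  in \<open>\<tau>\<close> converge at infinity because \<open>u\<close> is bounded, and at \<open>0\<close> because \<open>P\<^sub>\<tau> w - w = O(\<tau>)\<close> at a
  point where \<open>w\<close> has a first-order Taylor expansion with quadratic remainder: with \<open>\<tau> K(\<tau>) = L L\<^sup>T\<close>,
  the kernel is the image of the Gaussian of covariance \<open>2 I\<close> under \<open>z \<mapsto> e\<^sup>\<tau>\<^sup>B X + L z\<close>, so its first moments
  differ from \<open>X\<close> by \<open>O(\<tau>)\<close> and its second moments are of order \<open>norm (\<tau> K(\<tau>)) = O(\<tau>)\<close>.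
\<close>

subsection \<open>Linear change of variables for Lebesgue measure\<close>

text \<open>The order \<open>O(\<tau>)\<close> is what makes every \<open>s\<close> admissible: a
  Lipschitz bound alone gives \<open>O(sqrt \<tau>)\<close>, and
  \<open>\<tau> powr (- 1 / 2 - s)\<close> is integrable at \<open>0\<close> only for
  \<open>s < 1 / 2\<close>. The gain is due to symmetry: the first-order term integrates to zero
  over \<open>L z\<close> and leaves only the drift of the mean.

  The kernel contains the inverse and the determinant of a matrix known only as an integral. Any
  factor \<open>L\<close> with \<open>\<tau> K(\<tau>) = L L\<^sup>T\<close> removes both; the price
  is a change of variables for arbitrary invertible matrices and a bound on \<open>norm L\<close>
  through \<open>L L\<^sup>T\<close>. Since \<open>L\<close> is chosen separately for each time, it
  says nothing about measurability in \<open>\<tau>\<close>, which rests on Cramer's rule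
  instead.\<close>

lemma borel_measurable_vec_nth [measurable]: "(\<lambda>x::real^'n. x $ i) \<in> borel_measurable borel"
  by (intro borel_measurable_continuous_onI continuous_intros)

lemma nn_integral_lborel_translate:
  fixes F :: "'a::euclidean_space \<Rightarrow> ennreal"
  assumes "F \<in> borel_measurable borel"
  shows "(\<integral>\<^sup>+x. F (x + t) \<partial>lborel) = (\<integral>\<^sup>+x. F x \<partial>lborel)"
proof -
  have "(\<integral>\<^sup>+x. F x \<partial>lborel) = (\<integral>\<^sup>+x. F x \<partial>distr lborel borel ((+) t))"
    by (simp add: lborel_distr_plus)
  also have "\<dots> = (\<integral>\<^sup>+x. F (t + x) \<partial>lborel)"
    using assms by (subst nn_integral_distr) auto
  finally show ?thesis by (simp add: add.commute)
qed

text \<open>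
  Fubini in the direction \<^term>\<open>axis m 1\<close> without splitting the space: the weight
  \<^term>\<open>indicator {0..1} (x $ m - r)\<close>, whose integral over \<^term>\<open>r\<close> is \<^term>\<open>1\<close>, is inserted and the
  translation by \<^term>\<open>r\<close> is moved to the other factor.
\<close>

lemma nn_integral_lborel_line:
  fixes F :: "real^'n \<Rightarrow> ennreal"
  assumes F[measurable]: "F \<in> borel_measurable borel"
  shows "(\<integral>\<^sup>+x. F x \<partial>lborel) =
    (\<integral>\<^sup>+x. indicator {0..1} (x $ m) * (\<integral>\<^sup>+r. F (x + r *\<^sub>R axis m 1) \<partial>lborel) \<partial>lborel)"
proof -
  have g1: "(\<integral>\<^sup>+r. indicator {0..1} (c - r) \<partial>lborel) = 1" for c :: real
  proof -
    have "(\<integral>\<^sup>+r. indicator {0..1} (c - r) \<partial>lborel) = (\<integral>\<^sup>+r. indicator {c-1..c} r \<partial>lborel)"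
      by (intro nn_integral_cong) (auto simp: indicator_def)
    then show ?thesis by simp
  qed
  have "(\<integral>\<^sup>+x. F x \<partial>lborel) = (\<integral>\<^sup>+x. F x * (\<integral>\<^sup>+r. indicator {0..1} (x $ m - r) \<partial>lborel) \<partial>lborel)"
    by (simp add: g1)
  also have "\<dots> = (\<integral>\<^sup>+x. (\<integral>\<^sup>+r. indicator {0..1} (x $ m - r) * F x \<partial>lborel) \<partial>lborel)"
    by (intro nn_integral_cong) (simp add: mult.commute flip: nn_integral_cmult)
  also have "\<dots> = (\<integral>\<^sup>+r. (\<integral>\<^sup>+x. indicator {0..1} (x $ m - r) * F x \<partial>lborel) \<partial>lborel)"
    by (rule lborel_pair.Fubini') simp
  also have "\<dots> = (\<integral>\<^sup>+r. (\<integral>\<^sup>+x. indicator {0..1} (x $ m) * F (x + r *\<^sub>R axis m 1) \<partial>lborel) \<partial>lborel)"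
  proof (rule nn_integral_cong)
    fix r :: real
    show "(\<integral>\<^sup>+x. indicator {0..1} (x $ m - r) * F x \<partial>lborel) =
      (\<integral>\<^sup>+x. indicator {0..1} (x $ m) * F (x + r *\<^sub>R axis m 1) \<partial>lborel)"
      by (subst nn_integral_lborel_translate[where t = "r *\<^sub>R axis m 1", symmetric])
        (auto simp: axis_def)
  qed
  also have "\<dots> = (\<integral>\<^sup>+x. (\<integral>\<^sup>+r. indicator {0..1} (x $ m) * F (x + r *\<^sub>R axis m 1) \<partial>lborel) \<partial>lborel)"
    by (rule lborel_pair.Fubini'[symmetric]) simp
  finally show ?thesis
    by (simp add: nn_integral_cmult)
qed

text \<open>Along a line in direction \<open>axis m 1\<close> the coordinate \<open>x $ n\<close> is
  constant, because \<open>m \<noteq> n\<close>. On each such line the shear is a translation, and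
  \<open>nn_integral_lborel_line\<close> reduces the claim to translation invariance in one
  variable.\<close>

lemma nn_integral_lborel_shear:
  fixes F :: "real^'n \<Rightarrow> ennreal"
  assumes F[measurable]: "F \<in> borel_measurable borel" and mn: "m \<noteq> n"
  shows "(\<integral>\<^sup>+x. F (\<chi> i. if i = m then x $ m + x $ n else x $ i) \<partial>lborel) = (\<integral>\<^sup>+x. F x \<partial>lborel)"
proof -
  have eq: "(\<chi> i. if i = m then x $ m + x $ n else x $ i) = x + (x $ n) *\<^sub>R axis m 1" for x :: "real^'n"
    by (auto simp: vec_eq_iff axis_def)
  have "(\<integral>\<^sup>+x. F (x + (x $ n) *\<^sub>R axis m 1) \<partial>lborel) =
     (\<integral>\<^sup>+x. indicator {0..1} (x $ m) * (\<integral>\<^sup>+r. F (x + (r + x $ n) *\<^sub>R axis m 1) \<partial>lborel) \<partial>lborel)"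
    using mn
    by (subst nn_integral_lborel_line[where m = m])
      (auto intro!: nn_integral_cong simp: axis_def algebra_simps)
  also have "\<dots> = (\<integral>\<^sup>+x. indicator {0..1} (x $ m) * (\<integral>\<^sup>+r. F (x + r *\<^sub>R axis m 1) \<partial>lborel) \<partial>lborel)"
  proof (rule nn_integral_cong)
    fix x :: "real^'n"
    show "indicator {0..1} (x $ m) * (\<integral>\<^sup>+r. F (x + (r + x $ n) *\<^sub>R axis m 1) \<partial>lborel) =
      indicator {0..1} (x $ m) * (\<integral>\<^sup>+r. F (x + r *\<^sub>R axis m 1) \<partial>lborel)"
      by (subst nn_integral_lborel_translate[where F = "\<lambda>r. F (x + r *\<^sub>R axis m 1)"]) auto
  qed
  finally show ?thesis
    unfolding eq by (simp flip: nn_integral_lborel_line)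
qed

lemma nn_integral_lborel_diagonal:
  fixes F :: "real^'n \<Rightarrow> ennreal"
  assumes F[measurable]: "F \<in> borel_measurable borel" and c: "\<And>i. c i \<noteq> 0"
  shows "(\<integral>\<^sup>+x. F x \<partial>lborel) = ennreal \<bar>\<Prod>i\<in>UNIV. c i\<bar> * (\<integral>\<^sup>+x. F (\<chi> i. c i * x $ i) \<partial>lborel)"
proof -
  \<comment> \<open>\<open>lborel_affine_euclidean\<close> indexes its scaling factors by basis
    vectors, so \<open>c\<close> is carried over from indices to the vectors
    \<open>axis i 1\<close>.\<close>
  define d :: "real^'n \<Rightarrow> real" where "d b = c (THE i. b = axis i 1)" for b
  have d: "d (axis i 1) = c i" for i
    by (simp add: d_def axis_eq_axis)
  have T: "(\<Sum>j\<in>Basis. (d j * (x \<bullet> j)) *\<^sub>R j) = (\<chi> i. c i * x $ i)" for x :: "real^'n"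
  proof -
    have "(\<Sum>j\<in>Basis. (d j * (x \<bullet> j)) *\<^sub>R j) = (\<Sum>i\<in>UNIV. (d (axis i 1) * (x \<bullet> axis i 1)) *\<^sub>R axis i 1)"
      unfolding Basis_vec_def by (subst sum.UNION_disjoint) (auto simp: axis_eq_axis)
    also have "\<dots> = (\<chi> i. c i * x $ i)"
      by (simp add: vec_eq_iff d inner_axis) (simp add: axis_def if_distrib cong: if_cong)
    finally show ?thesis .
  qed
  have P: "(\<Prod>j\<in>Basis. \<bar>d j\<bar>) = \<bar>\<Prod>i\<in>UNIV. c i\<bar>"
    unfolding Basis_vec_def by (subst prod.UNION_disjoint) (auto simp: axis_eq_axis d abs_prod)
  have "lborel = density (distr lborel borel (\<lambda>x. 0 + (\<Sum>j\<in>Basis. (d j * (x \<bullet> j)) *\<^sub>R j)))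
     (\<lambda>_::real^'n. ennreal (\<Prod>j\<in>Basis. \<bar>d j\<bar>))"
    by (rule lborel_affine_euclidean) (auto simp: Basis_vec_def d c)
  then have "lborel = density (distr lborel borel (\<lambda>x. \<chi> i. c i * x $ i)) (\<lambda>_::real^'n. ennreal \<bar>\<Prod>i\<in>UNIV. c i\<bar>)"
    unfolding P by (simp add: T)
  then have "(\<integral>\<^sup>+x. F x \<partial>lborel) =
     (\<integral>\<^sup>+x. F x \<partial>density (distr lborel borel (\<lambda>x. \<chi> i. c i * x $ i)) (\<lambda>_::real^'n. ennreal \<bar>\<Prod>i\<in>UNIV. c i\<bar>))"
    by simp
  moreover have "(\<lambda>x. \<chi> i. c i * x $ i) \<in> borel_measurable (borel :: (real^'n) measure)"
    by (intro borel_measurable_continuous_onI continuous_intros)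
  ultimately show ?thesis
    by (simp add: nn_integral_density nn_integral_distr nn_integral_cmult)
qed

text \<open>Lebesgue measure is determined by its values on boxes. The preimage of a box is the box
  with corners permuted by \<open>inv p\<close>, which has the same side lengths up to
  order.\<close>

lemma nn_integral_lborel_permute:
  fixes F :: "real^'n \<Rightarrow> ennreal"
  assumes F[measurable]: "F \<in> borel_measurable borel" and p: "p permutes UNIV"
  shows "(\<integral>\<^sup>+x. F (\<chi> i. x $ p i) \<partial>lborel) = (\<integral>\<^sup>+x. F x \<partial>lborel)"
proof -
  have T[measurable]: "(\<lambda>x. \<chi> i. x $ p i) \<in> borel_measurable (borel :: (real^'n) measure)"
    by (intro borel_measurable_continuous_onI continuous_intros)
  have P: "(\<Prod>b\<in>Basis. h b) = (\<Prod>i\<in>UNIV. h (axis i 1))" for h :: "real^'n \<Rightarrow> real"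
    unfolding Basis_vec_def by (subst prod.UNION_disjoint) (auto simp: axis_eq_axis)
  have "lborel = distr lborel borel (\<lambda>x::real^'n. \<chi> i. x $ p i)"
  proof (rule lborel_eqI)
    fix l u :: "real^'n" assume le: "\<And>b. b \<in> Basis \<Longrightarrow> l \<bullet> b \<le> u \<bullet> b"
    define l' u' where "l' = (\<chi> i. l $ inv p i)" and "u' = (\<chi> i. u $ inv p i)"
    have "(\<lambda>x. \<chi> i. x $ p i) -` box l u = box l' u'"
      by (auto simp: mem_box_cart l'_def u'_def) (metis permutes_inverses[OF p])+
    moreover have "\<And>b. b \<in> Basis \<Longrightarrow> l' \<bullet> b \<le> u' \<bullet> b"
    proof -
      fix b :: "real^'n" assume "b \<in> Basis"
      then obtain i where b: "b = axis i 1" by (auto simp: Basis_vec_def)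
      show "l' \<bullet> b \<le> u' \<bullet> b"
        using le[of "axis (inv p i) 1"] by (simp add: b inner_axis l'_def u'_def)
    qed
    moreover have "(\<Prod>b\<in>Basis. (u' - l') \<bullet> b) = (\<Prod>b\<in>Basis. (u - l) \<bullet> b)"
      unfolding P using prod.permute[OF permutes_inv[OF p], of "\<lambda>i. (u - l) \<bullet> axis i 1"]
      by (simp add: inner_axis l'_def u'_def o_def)
    ultimately show "emeasure (distr lborel borel (\<lambda>x::real^'n. \<chi> i. x $ p i)) (box l u) = (\<Prod>b\<in>Basis. (u - l) \<bullet> b)"
      by (simp add: emeasure_distr emeasure_lborel_box_eq)
  qed simp
  then have "(\<integral>\<^sup>+x. F x \<partial>lborel) = (\<integral>\<^sup>+x. F x \<partial>distr lborel borel (\<lambda>x::real^'n. \<chi> i. x $ p i))"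
    by simp
  also have "\<dots> = (\<integral>\<^sup>+x. F (\<chi> i. x $ p i) \<partial>lborel)"
    by (subst nn_integral_distr) auto
  finally show ?thesis by simp
qed

text \<open>Determinants multiply under composition, so the formula passes from two maps to their
  composite and only the elementary maps that generate all linear maps have to be treated.\<close>

lemma nn_integral_lborel_linear:
  fixes f :: "real^'n \<Rightarrow> real^'n" and F :: "real^'n \<Rightarrow> ennreal"
  assumes "linear f" "det (matrix f) \<noteq> 0" "F \<in> borel_measurable borel"
  shows "(\<integral>\<^sup>+x. F x \<partial>lborel) = ennreal \<bar>det (matrix f)\<bar> * (\<integral>\<^sup>+x. F (f x) \<partial>lborel)"
proof -
  \<comment> \<open>The induction visits singular maps too, hence the implication. If a composite
    has nonzero determinant, so have both factors.\<close>
  define P where "P f \<longleftrightarrow> linear f \<and> (det (matrix f) \<noteq> 0 \<longrightarrow> (\<forall>F\<in>borel_measurable borel.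
     (\<integral>\<^sup>+x. F x \<partial>lborel) = ennreal \<bar>det (matrix f)\<bar> * (\<integral>\<^sup>+x. F (f x) \<partial>lborel)))"
    for f :: "real^'n \<Rightarrow> real^'n"
  have "P f"
  proof (rule induct_linear_elementary[OF assms(1)])
    fix f g :: "real^'n \<Rightarrow> real^'n" assume lin: "linear f" "linear g" and Pf: "P f" and Pg: "P g"
    have D: "det (matrix (f \<circ> g)) = det (matrix f) * det (matrix g)"
      using lin by (simp add: matrix_compose det_mul)
    show "P (f \<circ> g)"
      unfolding P_def
    proof (intro conjI impI ballI)
      fix F :: "real^'n \<Rightarrow> ennreal" assume F[measurable]: "F \<in> borel_measurable borel"
      assume nz: "det (matrix (f \<circ> g)) \<noteq> 0"
      have [measurable]: "f \<in> borel_measurable borel"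
        using lin by (intro borel_measurable_continuous_onI linear_continuous_on) (simp add: linear_linear)
      have "(\<integral>\<^sup>+x. F x \<partial>lborel) = ennreal \<bar>det (matrix f)\<bar> * (\<integral>\<^sup>+x. F (f x) \<partial>lborel)"
        using Pf[unfolded P_def] nz F D by fastforce
      also have "(\<integral>\<^sup>+x. F (f x) \<partial>lborel) = ennreal \<bar>det (matrix g)\<bar> * (\<integral>\<^sup>+x. F (f (g x)) \<partial>lborel)"
        using Pg[unfolded P_def, THEN conjunct2, THEN mp, THEN bspec, of "\<lambda>x. F (f x)"] nz D by simp
      finally show "(\<integral>\<^sup>+x. F x \<partial>lborel) = ennreal \<bar>det (matrix (f \<circ> g))\<bar> * (\<integral>\<^sup>+x. F ((f \<circ> g) x) \<partial>lborel)"
        by (simp add: D abs_mult ennreal_mult mult.assoc)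
    qed (use lin in \<open>auto intro: linear_compose\<close>)
  next
    fix f :: "real^'n \<Rightarrow> real^'n" and i assume lin: "linear f" and z: "\<And>x. f x $ i = 0"
    \<comment> \<open>A map with a vanishing coordinate is singular, so the implication in
      \<open>P\<close> is vacuous.\<close>
    have "row i (matrix f) = 0"
      using z by (simp add: row_def matrix_def vec_eq_iff)
    then have "det (matrix f) = 0"
      by (rule det_zero_row)
    then show "P f" using lin by (simp add: P_def)
  next
    fix c :: "'n \<Rightarrow> real"
    have lin: "linear (\<lambda>x::real^'n. \<chi> i. c i * x $ i)"
      by (auto simp: linear_iff vec_eq_iff algebra_simps)
    have D: "det (matrix (\<lambda>x::real^'n. \<chi> i. c i * x $ i)) = (\<Prod>i\<in>UNIV. c i)"
      by (subst det_diagonal) (auto simp: matrix_def axis_def)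
    show "P (\<lambda>x. \<chi> i. c i * x $ i)"
      unfolding P_def D using lin by (auto intro!: nn_integral_lborel_diagonal)
  next
    fix m n :: 'n assume mn: "m \<noteq> n"
    let ?p = "Transposition.transpose m n"
    have p: "?p permutes UNIV" by (simp add: permutes_swap_id)
    have lin: "linear (\<lambda>x::real^'n. \<chi> i. x $ ?p i)"
      by (auto simp: linear_iff vec_eq_iff algebra_simps)
    have "matrix (\<lambda>x::real^'n. \<chi> i. x $ ?p i) = (\<chi> i j. mat 1 $ i $ ?p j)"
      by (auto simp: matrix_def vec_eq_iff axis_def mat_def Transposition.transpose_def)
    then have D: "\<bar>det (matrix (\<lambda>x::real^'n. \<chi> i. x $ ?p i))\<bar> = 1"
      using det_permute_columns[OF p, of "mat 1 :: real^'n^'n"] mn by (simp add: abs_mult sign_swap_id)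
    show "P (\<lambda>x. \<chi> i. x $ ?p i)"
      unfolding P_def D using lin nn_integral_lborel_permute[OF _ p] by simp
  next
    fix m n :: 'n assume mn: "m \<noteq> n"
    have lin: "linear (\<lambda>x::real^'n. \<chi> i. if i = m then x $ m + x $ n else x $ i)"
      by (auto simp: linear_iff vec_eq_iff algebra_simps)
    have "matrix (\<lambda>x::real^'n. \<chi> i. if i = m then x $ m + x $ n else x $ i) =
      (\<chi> k. if k = m then row m (mat 1) + 1 *s row n (mat 1) else row k (mat 1))"
      using mn by (auto simp: matrix_def vec_eq_iff axis_def mat_def row_def)
    then have D: "det (matrix (\<lambda>x::real^'n. \<chi> i. if i = m then x $ m + x $ n else x $ i)) = 1"
      by (simp only: det_row_operation[OF mn]) simp
    show "P (\<lambda>x. \<chi> i. if i = m then x $ m + x $ n else x $ i)"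
      unfolding P_def D using lin nn_integral_lborel_shear[OF _ mn] by simp
  qed
  then show ?thesis using assms by (simp add: P_def)
qed

text \<open>An equality of measures, rather than of nonnegative integrals, lets signed Bochner
  integrals be transported by the rules for \<open>distr\<close> and \<open>density\<close>.\<close>

lemma lborel_affine_matrix:
  fixes L :: "real^'n^'n"
  assumes "det L \<noteq> 0"
  shows "lborel = density (distr lborel borel (\<lambda>z. c + L *v z)) (\<lambda>_. ennreal \<bar>det L\<bar>)"
proof (rule measure_eqI)
  have [measurable]: "(\<lambda>z. c + L *v z) \<in> borel_measurable borel"
    by (intro borel_measurable_continuous_onI continuous_intros)
  fix A assume "A \<in> sets (lborel :: (real^'n) measure)"
  then have A[measurable]: "A \<in> sets borel" by simp
  have "emeasure lborel A = (\<integral>\<^sup>+x. indicator A x \<partial>lborel)"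
    by simp
  also have "\<dots> = (\<integral>\<^sup>+x. indicator A (x + c) \<partial>lborel)"
    by (subst nn_integral_lborel_translate) auto
  also have "\<dots> = ennreal \<bar>det L\<bar> * (\<integral>\<^sup>+z. indicator A (L *v z + c) \<partial>lborel)"
    using nn_integral_lborel_linear[of "(*v) L" "\<lambda>x. indicator A (x + c)"] assms by simp
  also have "(\<integral>\<^sup>+z. indicator A (L *v z + c) \<partial>lborel) = (\<integral>\<^sup>+z. indicator A z \<partial>distr lborel borel (\<lambda>z. c + L *v z))"
    by (subst nn_integral_distr) (auto simp: add.commute)
  finally show "emeasure lborel A = emeasure (density (distr lborel borel (\<lambda>z. c + L *v z)) (\<lambda>_. ennreal \<bar>det L\<bar>)) A"
    by (simp add: emeasure_density nn_integral_cmult)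
qed simp

subsection \<open>Positive definite matrices and the matrix exponential\<close>

text \<open>Gram-Schmidt for the inner product \<open>(A *v x) \<bullet> y\<close>. Fewer than
  \<open>CARD('n)\<close> vectors do not span the space, so some vector lies outside their span;
  minus its projection it is nonzero and can be normalized.\<close>

lemma orthonormal_set_pos_def:
  fixes A :: "real^'n^'n"
  assumes sym: "transpose A = A" and pos: "\<And>x. x \<noteq> 0 \<Longrightarrow> (A *v x) \<bullet> x > 0"
  assumes "k \<le> CARD('n)"
  shows "\<exists>S. finite S \<and> card S = k \<and> (\<forall>x\<in>S. \<forall>y\<in>S. (A *v x) \<bullet> y = (if x = y then 1 else 0))"
  using assms(3)
proof (induction k)
  case 0
  then show ?case by (intro exI[of _ "{}"]) auto
next
  case (Suc k)
  then obtain S where S: "finite S" "card S = k"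
    and on: "\<And>x y. x \<in> S \<Longrightarrow> y \<in> S \<Longrightarrow> (A *v x) \<bullet> y = (if x = y then 1 else 0)"
    by auto
  have comm: "(A *v x) \<bullet> y = (A *v y) \<bullet> x" for x y
    by (metis sym dot_lmul_matrix inner_commute vector_transpose_matrix)
  have "span S \<noteq> UNIV"
  proof
    assume "span S = UNIV"
    then have "CARD('n) \<le> card S"
      using dim_le_card'[of S] S by (metis DIM_cart DIM_real dim_UNIV dim_span mult.right_neutral)
    then show False using S Suc.prems by simp
  qed
  then obtain w where w: "w \<notin> span S" by auto
  define w' where "w' = w - (\<Sum>v\<in>S. ((A *v w) \<bullet> v) *\<^sub>R v)"
  have "(\<Sum>v\<in>S. ((A *v w) \<bullet> v) *\<^sub>R v) \<in> span S"
    by (intro span_sum span_scale span_base)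
  then have "w' \<noteq> 0" using w unfolding w'_def by auto
  then have p: "(A *v w') \<bullet> w' > 0" by (rule pos)
  have orth: "(A *v w') \<bullet> v = 0" if "v \<in> S" for v
  proof -
    have "(\<Sum>x\<in>S. ((A *v w) \<bullet> x) * ((A *v x) \<bullet> v)) = (\<Sum>x\<in>S. if x = v then (A *v w) \<bullet> v else 0)"
      using that by (intro sum.cong) (auto simp: on)
    also have "\<dots> = (A *v w) \<bullet> v" using S that by simp
    finally show ?thesis
      by (simp add: w'_def matrix_vector_mult_diff_distrib inner_diff_left linear_sum[OF matrix_vector_mul_linear]
          matrix_vector_mult_scaleR inner_sum_left)
  qed
  define c where "c = 1 / sqrt ((A *v w') \<bullet> w')"
  define v where "v = c *\<^sub>R w'"
  have cc: "c * c * ((A *v w') \<bullet> w') = 1"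
    using p by (simp add: c_def field_simps)
  have vv: "(A *v v) \<bullet> v = 1"
    using cc by (simp add: v_def matrix_vector_mult_scaleR mult.assoc)
  have vS: "(A *v v) \<bullet> x = 0" "(A *v x) \<bullet> v = 0" if "x \<in> S" for x
    using orth[OF that] comm[of x v] by (simp_all add: v_def matrix_vector_mult_scaleR)
  have "v \<notin> S" using vS(1)[of v] vv by auto
  then show ?case
    using S on vv vS by (intro exI[of _ "insert v S"]) auto
qed

text \<open>The columns of \<open>V\<close> are orthonormal for the form of \<open>A\<close>, that
  is \<open>transpose V ** A ** V = mat 1\<close>. A left inverse of a square matrix is a right
  inverse, so \<open>V ** transpose V ** A = mat 1\<close>, and \<open>L = A ** V\<close> satisfies
  \<open>L ** transpose L = A ** V ** transpose V ** A = A\<close>.\<close>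

lemma pos_def_factorization:
  fixes A :: "real^'n^'n"
  assumes sym: "transpose A = A" and pos: "\<And>x. x \<noteq> 0 \<Longrightarrow> (A *v x) \<bullet> x > 0"
  obtains L where "det L \<noteq> 0" "A = L ** transpose L"
proof -
  obtain S where S: "finite S" "card S = CARD('n)"
    and on: "\<And>x y. x \<in> S \<Longrightarrow> y \<in> S \<Longrightarrow> (A *v x) \<bullet> y = (if x = y then 1 else 0)"
    using orthonormal_set_pos_def[OF sym pos, of "CARD('n)"] by auto
  obtain h where h: "bij_betw h (UNIV :: 'n set) S"
    using finite_same_card_bij[of "UNIV :: 'n set" S] S by auto
  define V :: "real^'n^'n" where "V = (\<chi> i j. h j $ i)"
  have eq1: "(transpose V ** (A ** V)) $ i $ j = (A *v h j) \<bullet> h i" for i j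
    unfolding V_def matrix_matrix_mult_def transpose_def matrix_vector_mult_def inner_vec_def
    by (simp, intro sum.cong refl, rule mult.commute)
  have eq2: "(A *v h j) \<bullet> h i = mat 1 $ i $ j" for i j
  proof -
    have hS: "h j \<in> S" "h i \<in> S" and hi: "h j = h i \<longleftrightarrow> i = j"
      using bij_betwE[OF h] bij_betw_imp_inj_on[OF h] by (auto dest: injD)
    show ?thesis
      unfolding on[OF hS] hi mat_def by simp
  qed
  have 1: "transpose V ** (A ** V) = mat 1"
    unfolding vec_eq_iff eq1 eq2 by simp
  have "det (transpose V) * det (A ** V) = 1"
    using arg_cong[OF 1, of det] unfolding det_mul det_I .
  then have "det (A ** V) \<noteq> 0" by (metis mult_zero_right zero_neq_one)
  moreover have "(transpose V ** A) ** V = mat 1" using 1 unfolding matrix_mul_assoc .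
  then have 2: "V ** (transpose V ** A) = mat 1" by (rule matrix_left_right_inverse[THEN iffD1])
  have "(A ** V) ** transpose (A ** V) = A ** (V ** (transpose V ** A))"
    by (simp only: matrix_transpose_mul sym matrix_mul_assoc)
  then have "A = (A ** V) ** transpose (A ** V)"
    by (simp add: 2)
  ultimately show ?thesis by (rule that)
qed

section \<open>Matrix powers, and the entries of the exponential as power series\<close>

abbreviation matpow :: "real^'n^'n \<Rightarrow> nat \<Rightarrow> real^'n^'n" where
  "matpow A k \<equiv> ((\<lambda>M. A ** M) ^^ k) (mat 1)"

lemma matpow_commute: "A ** matpow A k = matpow A k ** A"
  by (induction k) (simp_all add: matrix_mul_assoc)

lemma transpose_matpow: "transpose (matpow A k) = matpow (transpose A) k"
  by (induction k) (simp_all add: matrix_transpose_mul matpow_commute)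

lemma matpow_scaleR: "matpow (c *\<^sub>R A) k = c ^ k *\<^sub>R matpow A k"
  by (induction k) (simp_all add: scalar_matrix_assoc matrix_scalar_ac mult.commute)

text \<open>The sum of all absolute entries bounds every row sum, so each multiplication by
  \<open>A\<close> costs one such factor, for all entries at once. This gives a scalar exponential
  series as majorant.\<close>

lemma abs_matpow_le: "\<bar>matpow A k $ i $ j\<bar> \<le> (\<Sum>i\<in>UNIV. \<Sum>j\<in>UNIV. \<bar>A $ i $ j\<bar>) ^ k"
proof (induction k arbitrary: i)
  case 0
  then show ?case by (auto simp: mat_def)
next
  case (Suc k)
  let ?a = "\<Sum>i\<in>UNIV. \<Sum>j\<in>UNIV. \<bar>A $ i $ j\<bar>"
  have "\<bar>matpow A (Suc k) $ i $ j\<bar> \<le> (\<Sum>l\<in>UNIV. \<bar>A $ i $ l * matpow A k $ l $ j\<bar>)"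
    by (simp add: matrix_matrix_mult_def)
  also have "\<dots> \<le> (\<Sum>l\<in>UNIV. \<bar>A $ i $ l\<bar> * ?a ^ k)"
    by (intro sum_mono) (simp add: abs_mult mult_left_mono Suc.IH)
  also have "\<dots> = (\<Sum>l\<in>UNIV. \<bar>A $ i $ l\<bar>) * ?a ^ k"
    by (simp add: sum_distrib_right)
  also have "\<dots> \<le> ?a * ?a ^ k"
    by (intro mult_right_mono member_le_sum[where f = "\<lambda>i. \<Sum>l\<in>UNIV. \<bar>A $ i $ l\<bar>"])
      (auto intro!: sum_nonneg zero_le_power)
  finally show ?case by simp
qed

text \<open>The factor \<open>c ^ k\<close> turns an entry of the exponential of
  \<open>c *\<^sub>R A\<close> into a power series in \<open>c\<close> that converges everywhere,
  ready for termwise differentiation.\<close>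

lemma summable_matpow_entry:
  fixes A :: "real^'n^'n"
  shows "summable (\<lambda>k. matpow A k $ i $ j / fact k * c ^ k)"
proof (rule summable_comparison_test')
  let ?a = "\<Sum>i\<in>UNIV. \<Sum>j\<in>UNIV. \<bar>A $ i $ j\<bar>"
  show "summable (\<lambda>k. inverse (fact k) * (?a * \<bar>c\<bar>) ^ k)"
    by (rule summable_exp)
  fix k :: nat assume "k \<ge> 0"
  show "norm (matpow A k $ i $ j / fact k * c ^ k) \<le> inverse (fact k) * (?a * \<bar>c\<bar>) ^ k"
    using mult_mono[OF abs_matpow_le[of k A i j] order_refl, of "\<bar>c\<bar> ^ k"]
    by (simp add: abs_mult power_mult_distrib power_abs field_simps zero_le_power sum_nonneg)
qed

text \<open>Taking an entry is bounded linear, but exchanging it with the infinite sum needs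
  convergence of the matrix series itself. Its norm is dominated by the sum of the absolute entries,
  each of which is summable.\<close>

lemma mat_exp_entry:
  fixes A :: "real^'n^'n"
  shows "mat_exp A $ i $ j = (\<Sum>k. matpow A k $ i $ j / fact k)"
proof -
  have s: "summable (\<lambda>k. (1 / fact k) *\<^sub>R matpow A k)"
  proof (rule summable_comparison_test')
    show "summable (\<lambda>k. \<Sum>i\<in>UNIV. \<Sum>j\<in>UNIV. \<bar>matpow A k $ i $ j / fact k\<bar>)"
    proof (rule summable_sum, rule summable_sum)
      fix i j
      show "summable (\<lambda>k. \<bar>matpow A k $ i $ j / fact k\<bar>)"
      proof (rule summable_comparison_test')
        let ?a = "\<Sum>i\<in>UNIV. \<Sum>j\<in>UNIV. \<bar>A $ i $ j\<bar>"
        show "summable (\<lambda>k. inverse (fact k) * ?a ^ k)"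
          by (rule summable_exp)
        fix k :: nat assume "k \<ge> 0"
        show "norm \<bar>matpow A k $ i $ j / fact k\<bar> \<le> inverse (fact k) * ?a ^ k"
          using divide_right_mono[OF abs_matpow_le[of k A i j], of "fact k"]
            by (simp add: divide_inverse mult.commute abs_mult)
      qed
    qed
    fix k :: nat assume "k \<ge> 0"
    have "norm ((1 / fact k) *\<^sub>R matpow A k) \<le> (\<Sum>i\<in>UNIV. norm (((1 / fact k) *\<^sub>R matpow A k) $ i))"
      by (simp only: norm_vec_def) (rule L2_set_le_sum, simp)
    also have "\<dots> \<le> (\<Sum>i\<in>UNIV. \<Sum>j\<in>UNIV. \<bar>((1 / fact k) *\<^sub>R matpow A k) $ i $ j\<bar>)"
      by (intro sum_mono norm_le_l1_cart)
    finally show "norm ((1 / fact k) *\<^sub>R matpow A k) \<le> (\<Sum>i\<in>UNIV. \<Sum>j\<in>UNIV. \<bar>matpow A k $ i $ j / fact k\<bar>)"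
      by simp
  qed
  have "bounded_linear (\<lambda>M::real^'n^'n. M $ i $ j)"
    by (intro bounded_linear_compose[OF bounded_linear_vec_nth bounded_linear_vec_nth])
  from bounded_linear.suminf[OF this s] show ?thesis
    by (simp add: mat_exp_def)
qed

lemma mat_exp_scaleR_entry: "mat_exp (c *\<^sub>R A) $ i $ j = (\<Sum>k. matpow A k $ i $ j / fact k * c ^ k)"
  by (simp add: mat_exp_entry matpow_scaleR mult.commute)

lemma transpose_mat_exp: "transpose (mat_exp A) = mat_exp (transpose A)"
  by (simp add: vec_eq_iff mat_exp_entry flip: transpose_matpow) (simp add: transpose_def mat_exp_entry)

lemma mat_exp_scaleR_entry_has_field_derivative:
  "((\<lambda>c. mat_exp (c *\<^sub>R A) $ i $ j) has_field_derivative
     (\<Sum>k. diffs (\<lambda>k. matpow A k $ i $ j / fact k) k * c ^ k)) (at c)"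
  unfolding mat_exp_scaleR_entry
  by (rule termdiffs_strong_converges_everywhere) (rule summable_matpow_entry)

lemma continuous_on_mat_exp_entry: "continuous_on S (\<lambda>c. mat_exp (c *\<^sub>R A) $ i $ j)"
  by (intro continuous_at_imp_continuous_on ballI DERIV_isCont)
     (rule mat_exp_scaleR_entry_has_field_derivative)

lemma mat_exp_zero: "mat_exp 0 = mat 1"
proof -
  \<comment> \<open>Writing the zero matrix as a multiple with factor \<open>0\<close> makes it a
    power series at \<open>0\<close>, of which only the constant term survives.\<close>
  have "mat_exp (0 *\<^sub>R (0 :: real^'a^'a)) $ i $ j = mat 1 $ i $ j" for i j :: 'a
    unfolding mat_exp_scaleR_entry powser_zero by simp
  then show ?thesis by (simp add: vec_eq_iff)
qed

text \<open>The difference quotients tend to \<open>D\<close>, so near \<open>0\<close> they stay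
  below \<open>\<bar>D\<bar> + 1\<close> in absolute value.\<close>

lemma eventually_at_right_DERIV_le:
  fixes f :: "real \<Rightarrow> real"
  assumes "(f has_field_derivative D) (at 0)"
  shows "eventually (\<lambda>c. \<bar>f c - f 0\<bar> \<le> (\<bar>D\<bar> + 1) * c) (at_right 0)"
proof -
  have "((\<lambda>c. (f c - f 0) / (c - 0)) \<longlongrightarrow> D) (at_right 0)"
    using assms unfolding has_field_derivative_iff by (rule filterlim_mono[OF _ order_refl at_le]) auto
  then have "((\<lambda>c. \<bar>(f c - f 0) / c\<bar>) \<longlongrightarrow> \<bar>D\<bar>) (at_right 0)"
    by (auto intro!: tendsto_rabs simp del: abs_divide)
  then have "eventually (\<lambda>c. \<bar>(f c - f 0) / c\<bar> < \<bar>D\<bar> + 1) (at_right 0)"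
    by (rule order_tendstoD) simp
  moreover have "eventually (\<lambda>c::real. c > 0) (at_right 0)"
    by (rule eventually_at_right_less)
  ultimately show ?thesis
    by eventually_elim (simp add: field_simps abs_mult)
qed

lemma eventually_mat_exp_minus_id_le:
  fixes B :: "real^'n^'n"
  shows "\<exists>C. eventually (\<lambda>c. norm (mat_exp (c *\<^sub>R B) *v X - X) \<le> C * c) (at_right 0)"
proof -
  define f where "f i c = (mat_exp (c *\<^sub>R B) *v X) $ i" for i c
  have f0: "f i 0 = X $ i" for i by (simp add: f_def mat_exp_zero)
  have "\<exists>D. (f i has_field_derivative D) (at 0)" for i
    unfolding f_def matrix_vector_mult_def
    by (auto intro!: exI DERIV_sum DERIV_cmult_right mat_exp_scaleR_entry_has_field_derivative)
  then obtain D where D: "\<And>i. (f i has_field_derivative D i) (at 0)" by metis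
  have "eventually (\<lambda>c. \<forall>i\<in>UNIV. \<bar>f i c - f i 0\<bar> \<le> (\<bar>D i\<bar> + 1) * c) (at_right 0)"
    by (intro eventually_ball_finite ballI eventually_at_right_DERIV_le D) auto
  then have "eventually (\<lambda>c. norm (mat_exp (c *\<^sub>R B) *v X - X) \<le> (\<Sum>i\<in>UNIV. \<bar>D i\<bar> + 1) * c) (at_right 0)"
  proof eventually_elim
    case (elim c)
    have "norm (mat_exp (c *\<^sub>R B) *v X - X) \<le> (\<Sum>i\<in>UNIV. \<bar>(mat_exp (c *\<^sub>R B) *v X - X) $ i\<bar>)"
      by (rule norm_le_l1_cart)
    also have "\<dots> \<le> (\<Sum>i\<in>UNIV. (\<bar>D i\<bar> + 1) * c)"
      using elim by (intro sum_mono) (simp add: f0, simp add: f_def)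
    finally show ?case by (simp add: sum_distrib_right)
  qed
  then show ?thesis by blast
qed

subsection \<open>The covariance matrix\<close>

lemma matrix_inv_left_right:
  assumes "invertible A"
  shows matrix_inv_right: "A ** matrix_inv A = mat 1" and matrix_inv_left: "matrix_inv A ** A = mat 1"
  using someI_ex[OF assms[unfolded invertible_def]] by (simp_all add: matrix_inv_def)

lemma matrix_entry_inner: "M $ i $ j = (M *v axis j 1) \<bullet> axis i (1::real)"
  by (simp add: matrix_vector_mult_basis column_def inner_axis)

lemma symmetric_matrixI:
  fixes M :: "real^'n^'n"
  assumes "\<And>x y. (M *v x) \<bullet> y = (M *v y) \<bullet> x"
  shows "transpose M = M"
proof -
  have "transpose M $ i $ j = M $ i $ j" for i j
    using assms[of "axis i 1" "axis j 1"] by (simp add: transpose_def flip: matrix_entry_inner)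
  then show ?thesis by (simp add: vec_eq_iff)
qed

text \<open>If the form vanishes at \<open>x\<close>, then at \<open>x + r *\<^sub>R y\<close> with
  \<open>y = M *v x\<close> it equals \<open>2 * r * a + r * r * b\<close>. This is negative for
  small negative \<open>r\<close> unless \<open>a = 0\<close>, that is \<open>M *v x = 0\<close>,
  which invertibility excludes.\<close>

lemma pos_semidef_invertible_imp_pos_def:
  fixes M :: "real^'n^'n"
  assumes sym: "\<And>x y. (M *v x) \<bullet> y = (M *v y) \<bullet> x" and psd: "\<And>x. (M *v x) \<bullet> x \<ge> 0"
    and inv: "invertible M" and "x \<noteq> 0"
  shows "(M *v x) \<bullet> x > 0"
proof (rule ccontr)
  assume "\<not> (M *v x) \<bullet> x > 0"
  then have 0: "(M *v x) \<bullet> x = 0" using psd[of x] by simp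
  define y a b where "y = M *v x" and "a = y \<bullet> y" and "b = (M *v y) \<bullet> y"
  have b: "b \<ge> 0" using psd by (simp add: b_def)
  \<comment> \<open>The minimum is at \<open>- a / b\<close>; the \<open>+ 1\<close> keeps
    \<open>r\<close> meaningful for \<open>b = 0\<close>, and the value is still negative for
    \<open>a \<noteq> 0\<close>.\<close>
  define r where "r = - a / (b + 1)"
  have "0 \<le> (M *v (x + r *\<^sub>R y)) \<bullet> (x + r *\<^sub>R y)" by (rule psd)
  also have "\<dots> = r * ((M *v x) \<bullet> y) + r * ((M *v y) \<bullet> x) + r * r * b"
    by (simp add: matrix_vector_right_distrib matrix_vector_mult_scaleR inner_add_left inner_add_right 0
        b_def algebra_simps)
  also have "\<dots> = 2 * r * a + r * r * b"
    using sym[of x y] by (simp add: a_def y_def)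
  also have "\<dots> = - (a * a * (b + 2)) / ((b + 1) * (b + 1))"
    using b by (simp add: r_def divide_simps) (simp add: algebra_simps)
  finally have "0 \<le> - (a * a * (b + 2)) / ((b + 1) * (b + 1))" .
  moreover have "(b + 1) * (b + 1) > 0" using b by simp
  ultimately have "a * a * (b + 2) \<le> 0"
    by (simp add: field_split_simps)
  moreover have "a * a * (b + 2) \<ge> a * a"
    using mult_nonneg_nonneg[OF zero_le_square[of a] b] zero_le_square[of a]
    by (simp add: algebra_simps)
  ultimately have "a * a \<le> 0" by linarith
  then have "a * a = 0" by (metis antisym zero_le_square)
  then have "M *v x = 0" by (simp add: a_def y_def)
  then have "matrix_inv M *v (M *v x) = 0" by simp
  then show False
    using inv \<open>x \<noteq> 0\<close> by (simp add: matrix_vector_mul_assoc matrix_inv_left)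
qed

text \<open>Half the covariance of the transition kernel. Without the factor \<open>1 / t\<close> it
  stays continuous down to \<open>t = 0\<close>.\<close>

definition cov :: "real^'n^'n \<Rightarrow> real^'n^'n \<Rightarrow> real \<Rightarrow> real^'n^'n" where
  "cov Q B t = integral {0..t} (\<lambda>\<sigma>. mat_exp (\<sigma> *\<^sub>R B) ** Q ** mat_exp (\<sigma> *\<^sub>R transpose B))"

lemma cov_eq_scaleR_covK: "t > 0 \<Longrightarrow> t *\<^sub>R covK Q B t = cov Q B t"
  and covK_eq_scaleR_cov: "covK Q B t = (1 / t) *\<^sub>R cov Q B t"
  by (simp_all add: covK_def cov_def)

lemma continuous_on_cov_integrand:
  "continuous_on S (\<lambda>\<sigma>. mat_exp (\<sigma> *\<^sub>R B) ** Q ** mat_exp (\<sigma> *\<^sub>R transpose B))"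
  unfolding matrix_matrix_mult_def
  by (simp, intro continuous_on_vec_lambda continuous_on_sum continuous_on_mult continuous_on_const
      continuous_on_mat_exp_entry)

text \<open>The quadratic form is moved under the integral, where it becomes the form of
  \<open>Q\<close> at transformed vectors. Symmetry and nonnegativity then pass from
  \<open>Q\<close> to \<open>cov\<close> pointwise in \<open>\<sigma>\<close>.\<close>

lemma cov_inner:
  assumes "t \<ge> 0"
  shows "(cov Q B t *v x) \<bullet> y = integral {0..t} (\<lambda>\<sigma>.
    (Q *v (transpose (mat_exp (\<sigma> *\<^sub>R B)) *v x)) \<bullet> (transpose (mat_exp (\<sigma> *\<^sub>R B)) *v y))"
proof -
  have "linear (\<lambda>M. (M *v x) \<bullet> y)"
    by (auto simp: linear_iff matrix_vector_mult_add_rdistrib inner_add_left scaleR_matrix_vector_assoc[symmetric])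
  then have bl: "bounded_linear (\<lambda>M. (M *v x) \<bullet> y)"
    by (simp add: linear_conv_bounded_linear)
  have adj: "(E *v v) \<bullet> w = v \<bullet> (transpose E *v w)" for E :: "real^'a^'a" and v w
    by (metis dot_lmul_matrix inner_commute transpose_matrix_vector)
  show ?thesis
    unfolding cov_def
    by (subst integral_linear[OF _ bl, symmetric, unfolded o_def])
      (auto intro!: integrable_continuous_real continuous_on_cov_integrand
        simp: transpose_mat_exp transpose_scalar matrix_vector_mul_assoc[symmetric] adj)
qed

lemma cov_inner_commute:
  assumes "transpose Q = Q" "t \<ge> 0"
  shows "(cov Q B t *v x) \<bullet> y = (cov Q B t *v y) \<bullet> x"
proof -
  have "(Q *v a) \<bullet> b = (Q *v b) \<bullet> a" for a b
    by (metis assms(1) dot_lmul_matrix inner_commute transpose_matrix_vector)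
  then show ?thesis
    unfolding cov_inner[OF assms(2)] by (intro integral_cong)
qed

lemma cov_inner_nonneg:
  assumes "\<forall>x. (Q *v x) \<bullet> x \<ge> 0" "t \<ge> 0"
  shows "(cov Q B t *v x) \<bullet> x \<ge> 0"
  unfolding cov_inner[OF assms(2)]
  \<comment> \<open>\<open>integral_nonneg\<close> asks for integrability; in the other case
    \<open>integral\<close> has the default value \<open>0\<close>, which is nonnegative as
    well.\<close>
  by (metis (no_types, lifting) assms(1) integral_nonneg not_integrable_integral order_refl)

lemma cov_factorization:
  fixes Q B :: "real^'n^'n"
  assumes "transpose Q = Q" and "\<forall>x. (Q *v x) \<bullet> x \<ge> 0"
    and "\<forall>t>0. invertible (covK Q B t)" and t: "t > 0"
  obtains L where "det L \<noteq> 0" "cov Q B t = L ** transpose L"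
proof -
  have "invertible (covK Q B t)" using assms by blast
  then have "invertible (cov Q B t)"
    unfolding cov_eq_scaleR_covK[OF t, symmetric] using t by (simp add: invertible_def scalar_matrix_assoc matrix_scalar_ac)
      (metis (no_types, opaque_lifting) scaleR_one scaleR_scaleR left_inverse less_irrefl matrix_scalar_ac scalar_matrix_assoc)
  moreover have sym: "(cov Q B t *v x) \<bullet> y = (cov Q B t *v y) \<bullet> x" for x y
    using t assms by (simp add: cov_inner_commute)
  moreover have "(cov Q B t *v x) \<bullet> x \<ge> 0" for x
    using t assms by (simp add: cov_inner_nonneg)
  ultimately have "\<And>x. x \<noteq> 0 \<Longrightarrow> (cov Q B t *v x) \<bullet> x > 0"
    by (intro pos_semidef_invertible_imp_pos_def)
  moreover have "transpose (cov Q B t) = cov Q B t"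
    by (rule symmetric_matrixI) (rule sym)
  ultimately show ?thesis using pos_def_factorization that by metis
qed

text \<open>\<open>norm\<close> on matrices is the Frobenius norm, so Cauchy-Schwarz in each row
  suffices.\<close>

lemma norm_matrix_vector_mult_le:
  fixes L :: "real^'n^'m"
  shows "norm (L *v z) \<le> norm L * norm z"
proof -
  have "norm (L *v z) = L2_set (\<lambda>i. norm ((L *v z) $ i)) UNIV"
    by (simp add: norm_vec_def)
  also have "\<dots> \<le> L2_set (\<lambda>i. norm (L $ i) * norm z) UNIV"
    by (intro L2_set_mono) (simp_all add: matrix_vector_mul_component Cauchy_Schwarz_ineq2)
  also have "\<dots> = norm L * norm z"
    by (simp add: norm_vec_def[of L] L2_set_left_distrib)
  finally show ?thesis .
qed

text \<open>The squared Frobenius norm of \<open>L\<close> is the trace of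
  \<open>L ** transpose L\<close>, a sum of \<open>CARD('n)\<close> diagonal entries. This controls
  a factor about which nothing but its product with its transpose is known.\<close>

lemma norm_factor_square_le:
  fixes L :: "real^'n^'n"
  shows "(norm L)\<^sup>2 \<le> CARD('n) * norm (L ** transpose L)"
proof -
  have "(norm L)\<^sup>2 = (\<Sum>i\<in>UNIV. (norm (L $ i))\<^sup>2)"
    by (simp add: norm_vec_def[of L] L2_set_def sum_nonneg)
  also have "\<dots> = (\<Sum>i\<in>UNIV. (L ** transpose L) $ i $ i)"
    by (simp add: matrix_matrix_mult_def transpose_def power2_norm_eq_inner inner_vec_def)
  also have "\<dots> \<le> (\<Sum>i\<in>(UNIV::'n set). norm (L ** transpose L))"
  proof (intro sum_mono)
    fix i
    have "(L ** transpose L) $ i $ i \<le> norm ((L ** transpose L) $ i $ i)" by simp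
    also have "\<dots> \<le> norm (L ** transpose L)"
      by (rule order_trans[OF Finite_Cartesian_Product.norm_nth_le Finite_Cartesian_Product.norm_nth_le])
    finally show "(L ** transpose L) $ i $ i \<le> norm (L ** transpose L)" .
  qed
  finally show ?thesis by simp
qed

lemma eventually_norm_cov_le: "\<exists>C. eventually (\<lambda>t. norm (cov Q B t) \<le> C * t) (at_right 0)"
proof -
  let ?G = "\<lambda>\<sigma>. mat_exp (\<sigma> *\<^sub>R B) ** Q ** mat_exp (\<sigma> *\<^sub>R transpose B)"
  have "compact (?G ` {0..1})"
    by (intro compact_continuous_image continuous_on_cov_integrand) simp
  then have "bounded (?G ` {0..1})" by (rule compact_imp_bounded)
  then obtain C where "\<forall>M\<in>?G ` {0..1}. norm M \<le> C" unfolding bounded_iff by blast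
  then have C: "norm (?G \<sigma>) \<le> C" if "0 \<le> \<sigma>" "\<sigma> \<le> 1" for \<sigma>
    using that by auto
  have "norm (cov Q B t) \<le> C * t" if "0 < t" "t < 1" for t
    unfolding cov_def
    using integral_bound[OF _ continuous_on_cov_integrand, of 0 t B Q C] that C by auto
  then have "eventually (\<lambda>t. norm (cov Q B t) \<le> C * t) (at_right 0)"
    unfolding eventually_at_right_field by (intro exI[of _ 1]) simp
  then show ?thesis by blast
qed

text \<open>\<open>max 0 t\<close> freezes the matrix at time \<open>0\<close> for negative times;
  continuity of the indefinite integral on each \<open>{0..a}\<close> thereby becomes continuity on
  the whole line.\<close>

lemma borel_measurable_cov_entry [measurable]:
  "(\<lambda>t. cov Q B (max 0 t) $ i $ j) \<in> borel_measurable borel"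
proof -
  let ?G = "\<lambda>\<sigma>. mat_exp (\<sigma> *\<^sub>R B) ** Q ** mat_exp (\<sigma> *\<^sub>R transpose B)"
  have "continuous_on {0..a} (cov Q B)" for a
    unfolding cov_def[abs_def]
    by (intro indefinite_integral_continuous_1 integrable_continuous_real continuous_on_cov_integrand)
  then have "isCont (\<lambda>t. cov Q B (max 0 t)) s" for s
  proof -
    have "continuous_on {..\<bar>s\<bar> + 1} (\<lambda>t. cov Q B (max 0 t))"
      by (rule continuous_on_compose2[OF \<open>continuous_on {0..\<bar>s\<bar> + 1} (cov Q B)\<close>])
        (auto intro!: continuous_intros)
    then have "continuous_on {..<\<bar>s\<bar> + 1} (\<lambda>t. cov Q B (max 0 t))"
      by (rule continuous_on_subset) auto
    then show ?thesis
      using continuous_on_eq_continuous_at[of "{..<\<bar>s\<bar> + 1}"] by force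
  qed
  then have "continuous_on UNIV (\<lambda>t. cov Q B (max 0 t))"
    by (simp add: continuous_at_imp_continuous_on)
  then show ?thesis
    by (intro borel_measurable_continuous_onI continuous_intros)
qed

lemma borel_measurable_det:
  assumes [measurable]: "\<And>i j. (\<lambda>x. A x i j :: real) \<in> borel_measurable M"
  shows "(\<lambda>x. det (\<chi> i j. A x i j)) \<in> borel_measurable M"
  unfolding det_def by simp

text \<open>Cramer's rule. It replaces \<open>matrix_inv\<close>, which is defined by choice, with
  quotients of determinants, so that measurability in the entries becomes visible.\<close>

lemma matrix_inv_vector_mult:
  fixes A :: "real^'n^'n"
  assumes "invertible A"
  shows "matrix_inv A *v y = (\<chi> k. det (\<chi> i j. if j = k then y $ i else A $ i $ j) / det A)"
proof -
  have "A *v (matrix_inv A *v y) = y"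
    using assms by (simp add: matrix_vector_mul_assoc matrix_inv_right)
  then show ?thesis
    using cramer[of A "matrix_inv A *v y" y] assms by (simp add: invertible_det_nz)
qed

subsection \<open>The Gaussian kernel\<close>

text \<open>The heat kernel at time \<open>1\<close>, which is also \<open>kernel\<close> when its
  mean is \<open>0\<close> and \<open>t *\<^sub>R covK Q B t\<close> is the identity.\<close>

definition gauss :: "'a::euclidean_space \<Rightarrow> real" where
  "gauss z = (4 * pi) powr (- real DIM('a) / 2) * exp (- (z \<bullet> z) / 4)"

lemma gauss_nonneg: "gauss z \<ge> 0"
  by (simp add: gauss_def)

lemma gauss_uminus: "gauss (- z) = gauss z"
  by (simp add: gauss_def)

lemma borel_measurable_gauss [measurable]: "gauss \<in> borel_measurable borel"
  unfolding gauss_def[abs_def] by measurable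

lemma gauss_eq_prod_normal_density:
  "gauss (z::'a::euclidean_space) = (\<Prod>b\<in>Basis. normal_density 0 (sqrt 2) (z \<bullet> b))"
proof -
  have "(\<Prod>b\<in>(Basis::'a set). normal_density 0 (sqrt 2) (z \<bullet> b)) =
    (\<Prod>b\<in>(Basis::'a set). (4 * pi) powr (- 1 / 2)) * (\<Prod>b\<in>Basis. exp (- ((z \<bullet> b)\<^sup>2) / 4))"
    by (simp add: normal_density_def prod_dividef power_one_over powr_minus_divide powr_half_sqrt)
  also have "(\<Prod>b\<in>(Basis::'a set). (4 * pi) powr (- 1 / 2)) = (4 * pi) powr (- real DIM('a) / 2)"
    by (simp add: powr_power)
  also have "(\<Prod>b\<in>Basis. exp (- ((z \<bullet> b)\<^sup>2) / 4)) = exp (- (z \<bullet> z) / 4)"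
    by (simp add: exp_sum[symmetric] euclidean_inner[of z z] power2_eq_square sum_divide_distrib sum_negf)
  finally show ?thesis by (simp add: gauss_def)
qed

text \<open>\<open>gauss\<close> is a product of normal densities of variance \<open>2\<close>; all
  factors but the one for \<open>c\<close> integrate to \<open>1\<close>, so moments reduce to
  dimension one.\<close>

lemma nn_integral_gauss_coordinate:
  assumes c: "c \<in> Basis" and h: "h \<in> borel_measurable borel" "\<And>x. h x \<ge> 0"
  shows "(\<integral>\<^sup>+z. ennreal (gauss (z::'a::euclidean_space) * h (z \<bullet> c)) \<partial>lborel) =
     (\<integral>\<^sup>+x. ennreal (normal_density 0 (sqrt 2) x * h x) \<partial>lborel)"
proof -
  let ?f = "\<lambda>b x. ennreal (normal_density 0 (sqrt 2) x * (if b = c then h x else 1))"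
  have n1: "(\<integral>\<^sup>+x. ennreal (normal_density 0 (sqrt 2) x) \<partial>lborel) = 1"
    by (subst nn_integral_eq_integral) (auto simp: integral_normal_density)
  have "(\<integral>\<^sup>+z. ennreal (gauss (z::'a) * h (z \<bullet> c)) \<partial>lborel) = (\<integral>\<^sup>+z. (\<Prod>b\<in>Basis. ?f b (z \<bullet> b)) \<partial>lborel)"
  proof (rule nn_integral_cong)
    fix z :: 'a
    have "(\<Prod>b\<in>Basis. normal_density 0 (sqrt 2) (z \<bullet> b) * (if b = c then h (z \<bullet> b) else 1)) = gauss z * h (z \<bullet> c)"
      using c by (simp add: prod.distrib gauss_eq_prod_normal_density prod.delta)
    then show "ennreal (gauss z * h (z \<bullet> c)) = (\<Prod>b\<in>Basis. ?f b (z \<bullet> b))"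
      using h by (simp add: prod_ennreal)
  qed
  also have "\<dots> = (\<Prod>b\<in>(Basis :: 'a set). (\<integral>\<^sup>+x. ?f b x \<partial>lborel))"
    using h by (intro nn_integral_lborel_prod) auto
  also have "\<dots> = (\<Prod>b\<in>(Basis :: 'a set). if b = c then (\<integral>\<^sup>+x. ennreal (normal_density 0 (sqrt 2) x * h x) \<partial>lborel) else 1)"
    by (intro prod.cong) (auto simp: n1)
  finally show ?thesis using c by simp
qed

lemma has_bochner_integral_gauss: "has_bochner_integral lborel (gauss :: 'a::euclidean_space \<Rightarrow> real) 1"
proof (rule has_bochner_integral_nn_integral)
  obtain c :: 'a where "c \<in> Basis" using nonempty_Basis by blast
  from nn_integral_gauss_coordinate[OF this, of "\<lambda>_. 1"]
  show "(\<integral>\<^sup>+z. ennreal (gauss (z::'a)) \<partial>lborel) = ennreal 1"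
    by (simp, subst nn_integral_eq_integral) (auto simp: integral_normal_density)
qed (auto simp: gauss_nonneg)

lemma has_bochner_integral_gauss_norm_square:
  "has_bochner_integral lborel (\<lambda>z::'a::euclidean_space. gauss z * (norm z)\<^sup>2) (2 * real DIM('a))"
proof -
  have "has_bochner_integral lborel (\<lambda>z::'a. gauss z * (z \<bullet> c)\<^sup>2) 2" if "c \<in> Basis" for c
  proof (rule has_bochner_integral_nn_integral)
    have "has_bochner_integral lborel (\<lambda>x. normal_density 0 (sqrt 2) x * x\<^sup>2) 2"
      using normal_moment_even[of "sqrt 2" 0 1] by simp
    then have "(\<integral>\<^sup>+x. ennreal (normal_density 0 (sqrt 2) x * x\<^sup>2) \<partial>lborel) = ennreal 2"
      by (subst nn_integral_eq_integral) (auto simp: has_bochner_integral_iff)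
    with nn_integral_gauss_coordinate[OF that, of "\<lambda>x. x\<^sup>2"]
    show "(\<integral>\<^sup>+z. ennreal (gauss (z::'a) * (z \<bullet> c)\<^sup>2) \<partial>lborel) = ennreal 2" by simp
  qed (auto simp: gauss_nonneg)
  then have "has_bochner_integral lborel (\<lambda>z::'a. \<Sum>c\<in>Basis. gauss z * (z \<bullet> c)\<^sup>2) (\<Sum>c\<in>(Basis::'a set). 2)"
    by (intro has_bochner_integral_sum)
  moreover have "(\<Sum>c\<in>Basis. gauss z * (z \<bullet> c)\<^sup>2) = gauss z * (norm z)\<^sup>2" for z :: 'a
  proof -
    have "(norm z)\<^sup>2 = (\<Sum>c\<in>Basis. (z \<bullet> c)\<^sup>2)"
      unfolding power2_norm_eq_inner by (subst euclidean_inner) (simp add: power2_eq_square)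
    then show ?thesis by (simp only: sum_distrib_left)
  qed
  ultimately show ?thesis
    by (simp add: mult.commute)
qed

text \<open>The integrand is odd, and reflection is the affine map with factor \<open>-1\<close>, of
  density \<open>1\<close>. Integrability is proved separately, by domination with the moments of
  order 0 and 2.\<close>

lemma has_bochner_integral_gauss_inner:
  "has_bochner_integral lborel (\<lambda>z::'a::euclidean_space. gauss z * (v \<bullet> z)) 0"
proof -
  have int: "integrable lborel (\<lambda>z::'a. gauss z * (v \<bullet> z))"
  proof (rule Bochner_Integration.integrable_bound)
    show "integrable lborel (\<lambda>z::'a. norm v * (gauss z + gauss z * (norm z)\<^sup>2))"
      using has_bochner_integral_gauss[where 'a='a] has_bochner_integral_gauss_norm_square[where 'a='a]
      by (auto simp: has_bochner_integral_iff)
    show "AE z in lborel. norm (gauss z * (v \<bullet> z)) \<le> norm (norm v * (gauss z + gauss z * (norm z)\<^sup>2))"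
    proof (rule AE_I2)
      fix z :: 'a
      \<comment> \<open>From \<open>(norm z - 1 / 2)\<^sup>2 \<ge> 0\<close>.\<close>
      have "norm z \<le> 1 + (norm z)\<^sup>2"
        using zero_le_power2[of "norm z - 1 / 2"] by (simp add: power2_eq_square algebra_simps)
      have "\<bar>v \<bullet> z\<bar> \<le> norm v * norm z" by (rule Cauchy_Schwarz_ineq2)
      also have "\<dots> \<le> norm v * (1 + (norm z)\<^sup>2)"
        using \<open>norm z \<le> 1 + (norm z)\<^sup>2\<close> by (intro mult_left_mono) auto
      finally have "gauss z * \<bar>v \<bullet> z\<bar> \<le> gauss z * (norm v * (1 + (norm z)\<^sup>2))"
        by (intro mult_left_mono gauss_nonneg)
      then show "norm (gauss z * (v \<bullet> z)) \<le> norm (norm v * (gauss z + gauss z * (norm z)\<^sup>2))"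
        by (simp add: abs_mult gauss_nonneg algebra_simps)
    qed
  qed measurable
  have "(\<integral>z. gauss z * (v \<bullet> z) \<partial>lborel) =
     (\<integral>z. gauss z * (v \<bullet> z) \<partial>density (distr lborel borel (\<lambda>x. 0 + (-1) *\<^sub>R x)) (\<lambda>_. ennreal (\<bar>-1\<bar> ^ DIM('a))))"
    by (rule arg_cong[OF lborel_affine[of "-1" "0::'a"], of "\<lambda>M. \<integral>z. gauss z * (v \<bullet> z) \<partial>M"]) simp
  also have "\<dots> = (\<integral>z. - (gauss z * (v \<bullet> z)) \<partial>lborel)"
    by (simp add: density_1 integral_distr gauss_uminus)
  finally have "(\<integral>z. gauss z * (v \<bullet> z) \<partial>lborel) = 0" by simp
  with int show ?thesis by (simp add: has_bochner_integral_iff)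
qed

section \<open>The transition kernel as an affine image of the standard Gaussian\<close>

lemma kernel_nonneg: "kernel Q B X Y t \<ge> 0"
  by (simp add: kernel_def)

text \<open>Under \<open>Y = m + L *v z\<close>, with \<open>m\<close> the mean, the exponent
  becomes \<open>- (z \<bullet> z) / 4\<close>, and the power of the determinant equals
  \<open>1 / \<bar>det L\<bar>\<close>, which cancels the Jacobian.\<close>

lemma kernel_eq_gauss:
  fixes Q B L :: "real^'n^'n"
  assumes t: "t > 0" and L: "det L \<noteq> 0" "cov Q B t = L ** transpose L"
  shows "\<bar>det L\<bar> * kernel Q B X (mat_exp (t *\<^sub>R B) *v X + L *v z) t = gauss z"
proof -
  have inv: "invertible L" "invertible (transpose L)"
    using L by (simp_all add: invertible_det_nz)
  \<comment> \<open>The candidate for \<open>matrix_inv (covK Q B t) *v (L *v z)\<close>, found by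
    cancelling \<open>L\<close> in \<open>covK Q B t *v w = L *v z\<close>.\<close>
  define w where "w = t *\<^sub>R (matrix_inv (transpose L) *v z)"
  have K: "covK Q B t = (1 / t) *\<^sub>R (L ** transpose L)"
    by (simp add: covK_eq_scaleR_cov L)
  have detS: "det (t *\<^sub>R covK Q B t) = (det L)\<^sup>2"
    using t by (simp add: K det_mul power2_eq_square)
  have tw: "transpose L *v w = t *\<^sub>R z"
    by (simp add: w_def matrix_vector_mult_scaleR matrix_vector_mul_assoc matrix_inv_right inv)
  then have Kw: "covK Q B t *v w = L *v z"
    using t by (simp add: K scaleR_matrix_vector_assoc[symmetric] matrix_vector_mul_assoc[symmetric] matrix_vector_mult_scaleR)
  \<comment> \<open>An explicit right inverse shows that \<open>covK Q B t\<close> is invertible, so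
    that \<open>matrix_inv\<close> is a genuine inverse.\<close>
  have "covK Q B t ** (t *\<^sub>R (matrix_inv (transpose L) ** matrix_inv L)) = L ** (transpose L ** matrix_inv (transpose L)) ** matrix_inv L"
    using t by (simp add: K matrix_scalar_ac scalar_matrix_assoc[symmetric] matrix_mul_assoc)
  also have "\<dots> = mat 1" by (simp add: matrix_inv_right inv)
  finally have "invertible (covK Q B t)" by (auto simp: invertible_right_inverse)
  then have "matrix_inv (covK Q B t) *v (L *v z) = w"
    by (simp add: Kw[symmetric] matrix_vector_mul_assoc matrix_inv_left)
  moreover have "w \<bullet> (L *v z) = t * (z \<bullet> z)"
    by (simp only: dot_lmul_matrix[symmetric] transpose_matrix_vector[symmetric] tw inner_scaleR_left)
  moreover have "((det L)\<^sup>2) powr (- 1 / 2) = 1 / \<bar>det L\<bar>"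
    using L by (simp add: powr_minus_divide powr_half_sqrt)
  ultimately show ?thesis
    using t L by (simp add: kernel_def detS gauss_def)
qed

lemma integral_kernel_eq_gauss:
  fixes Q B L :: "real^'n^'n" and f :: "real^'n \<Rightarrow> real"
  assumes t: "t > 0" and L: "det L \<noteq> 0" "cov Q B t = L ** transpose L"
    and k[measurable]: "(\<lambda>Y. kernel Q B X Y t) \<in> borel_measurable borel" and f[measurable]: "f \<in> borel_measurable borel"
    and hb: "has_bochner_integral lborel (\<lambda>z. gauss z * f (mat_exp (t *\<^sub>R B) *v X + L *v z)) I"
  shows "has_bochner_integral lborel (\<lambda>Y. kernel Q B X Y t * f Y) I"
proof -
  let ?T = "\<lambda>z. mat_exp (t *\<^sub>R B) *v X + L *v z"
  have [measurable]: "?T \<in> borel_measurable borel"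
    by (intro borel_measurable_continuous_onI continuous_intros)
  have eq: "\<bar>det L\<bar> *\<^sub>R (kernel Q B X (?T z) t * f (?T z)) = gauss z * f (?T z)" for z
    by (simp add: kernel_eq_gauss[OF t L, of X z, symmetric])
  have "has_bochner_integral lborel (\<lambda>z. \<bar>det L\<bar> *\<^sub>R (kernel Q B X (?T z) t * f (?T z))) I"
    using hb unfolding eq .
  then have "has_bochner_integral (distr lborel borel ?T) (\<lambda>Y. \<bar>det L\<bar> *\<^sub>R (kernel Q B X Y t * f Y)) I"
    by (intro has_bochner_integral_distr) auto
  then have "has_bochner_integral (density (distr lborel borel ?T) (\<lambda>_. ennreal \<bar>det L\<bar>)) (\<lambda>Y. kernel Q B X Y t * f Y) I"
    by (intro has_bochner_integral_density) auto
  then show ?thesis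
    by (subst lborel_affine_matrix[OF L(1), of "mat_exp (t *\<^sub>R B) *v X"])
qed

text \<open>Joint measurability in time and space is what makes the semigroup measurable in time. It
  is shown for an explicit formula \<open>k\<close> that agrees with \<open>kernel\<close> at
  positive times, with the inverse written by Cramer's rule.\<close>

lemma kernel_measurable_version:
  fixes Q B :: "real^'n^'n"
  assumes "\<forall>t>0. invertible (covK Q B t)"
  obtains k where "(\<lambda>p. k (fst p) (snd p)) \<in> borel_measurable (borel \<Otimes>\<^sub>M borel)"
    "\<And>t Y. t > 0 \<Longrightarrow> kernel Q B X Y t = k t Y"
proof
  define S where "S t = cov Q B (max 0 t)" for t
  define y where "y t Y = Y - mat_exp (t *\<^sub>R B) *v X" for t Y
  define K where "K t = (1 / t) *\<^sub>R S t" for t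
  \<comment> \<open>The quadratic form of the inverse of \<open>K t\<close> at \<open>y t Y\<close>,
    in Cramer's form.\<close>
  define q where "q t Y = (\<Sum>k\<in>UNIV. (det (\<chi> i j. if j = k then y t Y $ i else K t $ i $ j) /
     det (\<chi> i j. K t $ i $ j)) * y t Y $ k)" for t Y
  define k where "k t Y = (4 * pi) powr (- real CARD('n) / 2) * det (\<chi> i j. S t $ i $ j) powr (- 1 / 2) *
     exp (- q t Y / (4 * t))" for t Y
  have S[measurable]: "(\<lambda>t. S t $ i $ j) \<in> borel_measurable borel" for i j
    unfolding S_def by (rule borel_measurable_cov_entry)
  have E[measurable]: "(\<lambda>t. mat_exp (t *\<^sub>R B) $ i $ j) \<in> borel_measurable borel" for i j
    by (intro borel_measurable_continuous_onI continuous_on_mat_exp_entry)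
  have K[measurable]: "(\<lambda>t. K t $ i $ j) \<in> borel_measurable borel" for i j
    unfolding K_def by simp
  have y[measurable]: "(\<lambda>p. y (fst p) (snd p) $ i) \<in> borel_measurable (borel \<Otimes>\<^sub>M borel)" for i
    unfolding y_def matrix_vector_mult_def by simp
  have [measurable]: "(\<lambda>p. det (\<chi> i j. if j = k then y (fst p) (snd p) $ i else K (fst p) $ i $ j)) \<in>
    borel_measurable (borel \<Otimes>\<^sub>M borel)" for k
    by (rule borel_measurable_det) simp
  have [measurable]: "(\<lambda>p. det (\<chi> i j. K (fst p) $ i $ j)) \<in> borel_measurable (borel \<Otimes>\<^sub>M (borel :: (real^'n) measure))"
    by (rule borel_measurable_det) simp
  have [measurable]: "(\<lambda>p. det (\<chi> i j. S (fst p) $ i $ j)) \<in> borel_measurable (borel \<Otimes>\<^sub>M (borel :: (real^'n) measure))"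
    by (rule borel_measurable_det) simp
  show "(\<lambda>p. k (fst p) (snd p)) \<in> borel_measurable (borel \<Otimes>\<^sub>M borel)"
    unfolding k_def q_def by measurable
  fix t :: real and Y assume t: "t > 0"
  have KK: "covK Q B t = K t" using t by (simp add: K_def S_def covK_eq_scaleR_cov max_def)
  have "det (t *\<^sub>R covK Q B t) = det (S t)"
    using t by (simp add: KK K_def)
  moreover have "(matrix_inv (K t) *v y t Y) \<bullet> y t Y = q t Y"
    using assms t by (subst matrix_inv_vector_mult) (auto simp: KK[symmetric] q_def inner_vec_def)
  ultimately show "kernel Q B X Y t = k t Y"
    by (simp add: kernel_def k_def KK y_def)
qed

subsection \<open>Taylor expansion of Schwartz functions\<close>

lemma schwartz_iter_partial:
  assumes "u \<in> schwartz" "set bs \<subseteq> Basis"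
  shows "iter_partial bs u differentiable_on UNIV" "\<exists>C. \<forall>x. \<bar>iter_partial bs u x\<bar> \<le> C"
proof -
  show "iter_partial bs u differentiable_on UNIV"
    using assms by (simp add: schwartz_def smooth_def)
  have "\<exists>C. \<forall>x. (1 + norm x) ^ 0 * \<bar>iter_partial bs u x\<bar> \<le> C"
    using assms unfolding schwartz_def by blast
  then show "\<exists>C. \<forall>x. \<bar>iter_partial bs u x\<bar> \<le> C" by simp
qed

lemma schwartz_iter_partial_has_derivative:
  assumes "u \<in> schwartz" "set bs \<subseteq> Basis"
  shows "(iter_partial bs u has_derivative (\<lambda>h. \<Sum>b\<in>Basis. (h \<bullet> b) * iter_partial (b # bs) u x)) (at x)"
proof -
  have "iter_partial bs u differentiable (at x)"
    using schwartz_iter_partial(1)[OF assms] by (simp add: differentiable_on_def)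
  then have D: "(iter_partial bs u has_derivative frechet_derivative (iter_partial bs u) (at x)) (at x)"
    by (simp add: frechet_derivative_works)
  then have lin: "linear (frechet_derivative (iter_partial bs u) (at x))"
    by (rule has_derivative_linear)
  have "frechet_derivative (iter_partial bs u) (at x) h = (\<Sum>b\<in>Basis. (h \<bullet> b) * iter_partial (b # bs) u x)" for h
  proof -
    have "frechet_derivative (iter_partial bs u) (at x) (\<Sum>b\<in>Basis. (h \<bullet> b) *\<^sub>R b) = (\<Sum>b\<in>Basis. (h \<bullet> b) * iter_partial (b # bs) u x)"
      by (simp add: linear_sum[OF lin] linear_scale[OF lin])
    then show ?thesis by (simp add: euclidean_representation)
  qed
  then show ?thesis using D by (metis (no_types, lifting) ext)
qed

text \<open>Bounded partial derivatives of the next order bound the operator norm of the derivative.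
  Order 0 is used for the square \<open>(u - u (X, r))\<^sup>2\<close>, order 1 for the Taylor
  remainder.\<close>

lemma schwartz_iter_partial_lipschitz:
  fixes u :: "'a::euclidean_space \<Rightarrow> real"
  assumes "u \<in> schwartz" "set bs \<subseteq> Basis"
  shows "\<exists>C. \<forall>x y. \<bar>iter_partial bs u x - iter_partial bs u y\<bar> \<le> C * norm (x - y)"
proof -
  have "\<forall>b\<in>Basis. \<exists>C. \<forall>x. \<bar>iter_partial (b # bs) u x\<bar> \<le> C"
    using assms by (intro ballI schwartz_iter_partial(2)) auto
  then obtain C where C: "\<And>b x. b \<in> Basis \<Longrightarrow> \<bar>iter_partial (b # bs) u x\<bar> \<le> C b"
    by metis
  have "\<bar>iter_partial bs u x - iter_partial bs u y\<bar> \<le> (\<Sum>b\<in>Basis. C b) * norm (x - y)" for x y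
  proof -
    have "norm (iter_partial bs u x - iter_partial bs u y) \<le> (\<Sum>b\<in>Basis. C b) * norm (x - y)"
    proof (rule differentiable_bound[OF convex_UNIV])
      fix z :: 'a
      show "(iter_partial bs u has_derivative (\<lambda>h. \<Sum>b\<in>Basis. (h \<bullet> b) * iter_partial (b # bs) u z)) (at z)"
        by (rule schwartz_iter_partial_has_derivative[OF assms])
      show "onorm (\<lambda>h. \<Sum>b\<in>Basis. (h \<bullet> b) * iter_partial (b # bs) u z) \<le> (\<Sum>b\<in>Basis. C b)"
      proof (rule onorm_le)
        fix h :: 'a
        have "norm (\<Sum>b\<in>Basis. (h \<bullet> b) * iter_partial (b # bs) u z) \<le> (\<Sum>b\<in>Basis. norm h * C b)"
          by (intro sum_norm_le) (simp add: abs_mult mult_mono C Basis_le_norm del: iter_partial.simps)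
        then show "norm (\<Sum>b\<in>Basis. (h \<bullet> b) * iter_partial (b # bs) u z) \<le> (\<Sum>b\<in>Basis. C b) * norm h"
          by (simp add: sum_distrib_left mult.commute)
      qed
    qed auto
    then show ?thesis by simp
  qed
  then show ?thesis by blast
qed

text \<open>By the mean value theorem the increment is the gradient at a point between
  \<open>z\<close> and \<open>z + h\<close>, applied to \<open>h\<close>. The gradient is Lipschitz,
  so replacing it by the one at \<open>z\<close> costs \<open>O((norm h)\<^sup>2)\<close>.\<close>

lemma schwartz_taylor:
  fixes u :: "'a::euclidean_space \<Rightarrow> real"
  assumes u: "u \<in> schwartz"
  obtains D C where "\<And>h. \<bar>u (z + h) - u z - D \<bullet> h\<bar> \<le> C * (norm h)\<^sup>2" "C \<ge> 0"
proof -
  have "\<forall>b\<in>Basis. \<exists>C. \<forall>x y. \<bar>iter_partial [b] u x - iter_partial [b] u y\<bar> \<le> C * norm (x - y)"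
    using u by (intro ballI schwartz_iter_partial_lipschitz) auto
  then obtain C where C: "\<And>b x y. b \<in> Basis \<Longrightarrow> \<bar>iter_partial [b] u x - iter_partial [b] u y\<bar> \<le> C b * norm (x - y)"
    by metis
  define D where "D = (\<Sum>b\<in>Basis. iter_partial [b] u z *\<^sub>R b)"
  \<comment> \<open>The points \<open>b\<close> and \<open>0\<close> are at distance
    \<open>1\<close>, so the Lipschitz bound between them is \<open>C b\<close> itself.\<close>
  have C0: "C b \<ge> 0" if "b \<in> Basis" for b
  proof -
    have "0 \<le> \<bar>iter_partial [b] u b - iter_partial [b] u 0\<bar>" by simp
    also have "\<dots> \<le> C b" using C[OF that, of b 0] that by simp
    finally show ?thesis .
  qed
  have der: "(u has_derivative (\<lambda>h. \<Sum>b\<in>Basis. (h \<bullet> b) * iter_partial [b] u x)) (at x)" for x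
    using schwartz_iter_partial_has_derivative[OF u, of "[]" x] by simp
  have "\<bar>u (z + h) - u z - D \<bullet> h\<bar> \<le> (\<Sum>b\<in>Basis. C b) * (norm h)\<^sup>2" for h
  proof -
    have "\<exists>x\<in>{0<..<1}. u (z + 1 *\<^sub>R h) - u (z + 0 *\<^sub>R h) =
        (\<lambda>k. \<Sum>b\<in>Basis. ((k *\<^sub>R h) \<bullet> b) * iter_partial [b] u (z + x *\<^sub>R h)) (1 - 0)"
    proof (rule mvt_simple)
      fix x :: real
      show "((\<lambda>x. u (z + x *\<^sub>R h)) has_derivative
        (\<lambda>k. \<Sum>b\<in>Basis. ((k *\<^sub>R h) \<bullet> b) * iter_partial [b] u (z + x *\<^sub>R h))) (at x within {0..1})"
        by (rule has_derivative_compose[OF _ der]) (auto intro!: derivative_eq_intros)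
    qed simp
    then obtain x where x: "0 < x" "x < 1"
      and eq: "u (z + h) - u z = (\<Sum>b\<in>Basis. (h \<bullet> b) * iter_partial [b] u (z + x *\<^sub>R h))"
      by auto
    have "u (z + h) - u z - D \<bullet> h = (\<Sum>b\<in>Basis. (h \<bullet> b) * (iter_partial [b] u (z + x *\<^sub>R h) - iter_partial [b] u z))"
      unfolding eq D_def
      by (simp add: inner_sum_left inner_sum_right inner_commute[of _ h] right_diff_distrib sum_subtractf mult.commute del: iter_partial.simps)
    also have "\<bar>\<dots>\<bar> \<le> (\<Sum>b\<in>Basis. norm h * (C b * norm h))"
      unfolding real_norm_def[symmetric]
    proof (rule sum_norm_le)
      fix b :: 'a assume b: "b \<in> Basis"
      have "\<bar>iter_partial [b] u (z + x *\<^sub>R h) - iter_partial [b] u z\<bar> \<le> C b * norm (x *\<^sub>R h)"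
        using C[OF b, of "z + x *\<^sub>R h" z] by simp
      also have "\<dots> \<le> C b * norm h"
        using x C0[OF b] by (intro mult_left_mono) (auto simp: mult_left_le_one_le)
      finally show "norm ((h \<bullet> b) * (iter_partial [b] u (z + x *\<^sub>R h) - iter_partial [b] u z)) \<le> norm h * (C b * norm h)"
        using b by (simp add: abs_mult mult_mono Basis_le_norm del: iter_partial.simps)
    qed
    also have "\<dots> = (\<Sum>b\<in>Basis. C b) * (norm h)\<^sup>2"
      by (simp add: sum_distrib_left sum_distrib_right power2_eq_square mult_ac)
    finally show ?thesis .
  qed
  then show ?thesis using C0 by (intro that[of D]) (auto intro: sum_nonneg)
qed

subsection \<open>The semigroup for small time\<close>

lemma has_bochner_integral_gauss_norm_matrix_square:
  fixes L :: "real^'n^'n"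
  obtains I where "has_bochner_integral lborel (\<lambda>z. gauss z * (norm (L *v z))\<^sup>2) I"
    "I \<le> 2 * CARD('n) * (norm L)\<^sup>2"
proof -
  let ?f = "\<lambda>z. gauss z * (norm (L *v z))\<^sup>2" and ?g = "\<lambda>z::real^'n. (norm L)\<^sup>2 * (gauss z * (norm z)\<^sup>2)"
  have g: "integrable lborel ?g" "(\<integral>z. ?g z \<partial>lborel) = 2 * CARD('n) * (norm L)\<^sup>2"
    using has_bochner_integral_gauss_norm_square[where 'a = "real^'n"]
    by (auto simp: has_bochner_integral_iff)
  have le: "?f z \<le> ?g z" for z
  proof -
    have "(norm (L *v z))\<^sup>2 \<le> (norm L * norm z)\<^sup>2"
      by (intro power_mono norm_matrix_vector_mult_le) auto
    from mult_left_mono[OF this gauss_nonneg[of z]] show ?thesis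
      by (simp add: power_mult_distrib mult_ac)
  qed
  have [measurable]: "(\<lambda>z. L *v z) \<in> borel_measurable borel"
    by (intro borel_measurable_continuous_onI continuous_intros)
  have f: "integrable lborel ?f"
    by (rule Bochner_Integration.integrable_bound[OF g(1)])
      (use le in \<open>auto simp: gauss_nonneg\<close>)
  have "(\<integral>z. ?f z \<partial>lborel) \<le> (\<integral>z. ?g z \<partial>lborel)"
    using f g(1) le by (rule integral_mono)
  then have "(\<integral>z. ?f z \<partial>lborel) \<le> 2 * CARD('n) * (norm L)\<^sup>2"
    by (simp only: g(2))
  with f show ?thesis
    by (intro that[of "\<integral>z. ?f z \<partial>lborel"]) (simp_all only: has_bochner_integral_iff simp_thms)
qed

context
  fixes Q B :: "real^'n^'n"
  assumes Q_sym: "transpose Q = Q" and Q_nonneg: "\<forall>x. (Q *v x) \<bullet> x \<ge> 0"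
    and covK_inv: "\<forall>t>0. invertible (covK Q B t)"
begin

lemma borel_measurable_kernel:
  assumes "t > 0"
  shows "(\<lambda>Y. kernel Q B X Y t) \<in> borel_measurable borel"
proof -
  obtain k where k: "(\<lambda>p. k (fst p) (snd p)) \<in> borel_measurable (borel \<Otimes>\<^sub>M borel)"
    "\<And>t Y. t > 0 \<Longrightarrow> kernel Q B X Y t = k t Y"
    by (rule kernel_measurable_version[OF covK_inv, where X = X]) blast
  have "(\<lambda>Y. k (fst (t, Y)) (snd (t, Y))) \<in> borel_measurable borel"
    by (rule measurable_compose[OF _ k(1)]) measurable
  then show ?thesis using k(2)[OF assms] by simp
qed

text \<open>Centred at the mean \<open>m\<close> rather than at \<open>X\<close>, these are moments
  of \<open>L *v z\<close>. The constant combines the second moment \<open>2 * CARD('n)\<close> of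
  \<open>gauss\<close> with the factor \<open>CARD('n)\<close> from
  \<open>norm_factor_square_le\<close>; the bound no longer depends on the chosen
  \<open>L\<close>.\<close>

lemma kernel_moments:
  fixes X v :: "real^'n"
  assumes t: "t > 0"
  defines "m \<equiv> mat_exp (t *\<^sub>R B) *v X"
  shows has_bochner_integral_kernel: "has_bochner_integral lborel (\<lambda>Y. kernel Q B X Y t) 1"
    and has_bochner_integral_kernel_inner:
      "has_bochner_integral lborel (\<lambda>Y. kernel Q B X Y t * (v \<bullet> (Y - m))) 0"
    and has_bochner_integral_kernel_norm_square:
      "\<exists>I. has_bochner_integral lborel (\<lambda>Y. kernel Q B X Y t * (norm (Y - m))\<^sup>2) I \<and>
         I \<le> 2 * (CARD('n))\<^sup>2 * norm (cov Q B t)"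
proof -
  obtain L where L: "det L \<noteq> 0" "cov Q B t = L ** transpose L"
    using cov_factorization[OF Q_sym Q_nonneg covK_inv t] .
  note push = integral_kernel_eq_gauss[OF t L borel_measurable_kernel[OF t], of _ X, folded m_def]
  show "has_bochner_integral lborel (\<lambda>Y. kernel Q B X Y t) 1"
    using push[of "\<lambda>_. 1" 1] has_bochner_integral_gauss[where 'a = "real^'n"] by simp
  have "v \<bullet> (m + L *v z - m) = (transpose L *v v) \<bullet> z" for z
    by (simp add: dot_lmul_matrix)
  then show "has_bochner_integral lborel (\<lambda>Y. kernel Q B X Y t * (v \<bullet> (Y - m))) 0"
    using has_bochner_integral_gauss_inner[of "transpose L *v v"] by (intro push) simp_all
  obtain I where I: "has_bochner_integral lborel (\<lambda>z. gauss z * (norm (L *v z))\<^sup>2) I"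
    "I \<le> 2 * CARD('n) * (norm L)\<^sup>2"
    using has_bochner_integral_gauss_norm_matrix_square .
  have "has_bochner_integral lborel (\<lambda>Y. kernel Q B X Y t * (norm (Y - m))\<^sup>2) I"
    using I(1) by (intro push) simp_all
  moreover have "I \<le> 2 * (CARD('n))\<^sup>2 * norm (cov Q B t)"
  proof -
    have "2 * real CARD('n) * (norm L)\<^sup>2 \<le> 2 * real CARD('n) * (CARD('n) * norm (cov Q B t))"
      unfolding L(2) by (intro mult_left_mono norm_factor_square_le) simp
    with I(2) have "I \<le> 2 * real CARD('n) * (CARD('n) * norm (cov Q B t))" by linarith
    then show ?thesis by (simp add: power2_eq_square mult_ac)
  qed
  ultimately show "\<exists>I. has_bochner_integral lborel (\<lambda>Y. kernel Q B X Y t * (norm (Y - m))\<^sup>2) I \<and>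
     I \<le> 2 * (CARD('n))\<^sup>2 * norm (cov Q B t)" by blast
qed

lemma integrable_kernel_bounded:
  assumes t: "t > 0" and w: "w \<in> borel_measurable borel" "\<And>z. \<bar>w z\<bar> \<le> M"
  shows "integrable lborel (\<lambda>Y. kernel Q B X Y t * w (Y, r))"
proof (rule Bochner_Integration.integrable_bound)
  show "integrable lborel (\<lambda>Y. M * kernel Q B X Y t)"
    using has_bochner_integral_kernel[OF t] by (auto simp: has_bochner_integral_iff)
  note [measurable] = w(1) borel_measurable_kernel[OF t]
  have [measurable]: "(\<lambda>Y. (Y, r)) \<in> borel_measurable (borel :: (real^'n) measure)"
    by (intro borel_measurable_continuous_onI continuous_intros)
  show "(\<lambda>Y. kernel Q B X Y t * w (Y, r)) \<in> borel_measurable lborel" by measurable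
  have "M \<ge> 0" using w(2)[of undefined] by linarith
  then show "AE Y in lborel. norm (kernel Q B X Y t * w (Y, r)) \<le> norm (M * kernel Q B X Y t)"
    by (intro AE_I2) (simp add: abs_mult kernel_nonneg mult.commute mult_right_mono w(2))
qed

lemma evol_semigroup_diff:
  assumes t: "t > 0" and w: "w \<in> borel_measurable borel" "\<And>z. \<bar>w z\<bar> \<le> M"
  shows "evol_semigroup Q B t w (X, r) - c = (\<integral>Y. kernel Q B X Y t * (w (Y, r - t) - c) \<partial>lborel)"
proof -
  have "(\<integral>Y. kernel Q B X Y t * (w (Y, r - t) - c) \<partial>lborel) =
      (\<integral>Y. kernel Q B X Y t * w (Y, r - t) \<partial>lborel) - (\<integral>Y. kernel Q B X Y t * c \<partial>lborel)"
    using integrable_kernel_bounded[OF assms] has_bochner_integral_kernel[OF t]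
    by (subst Bochner_Integration.integral_diff[symmetric])
      (auto simp: has_bochner_integral_iff right_diff_distrib)
  also have "(\<integral>Y. kernel Q B X Y t * c \<partial>lborel) = c"
    using has_bochner_integral_kernel[OF t] by (simp add: has_bochner_integral_iff)
  finally show ?thesis by (simp add: evol_semigroup_def)
qed

lemma abs_evol_semigroup_le:
  assumes t: "t > 0" and w: "w \<in> borel_measurable borel" "\<And>z. \<bar>w z\<bar> \<le> M"
  shows "\<bar>evol_semigroup Q B t w (X, r)\<bar> \<le> M"
proof -
  have "\<bar>\<integral>Y. kernel Q B X Y t * w (Y, r - t) \<partial>lborel\<bar> \<le> (\<integral>Y. M * kernel Q B X Y t \<partial>lborel)"
  proof (rule order_trans[OF integral_abs_bound integral_mono])
    show "integrable lborel (\<lambda>Y. \<bar>kernel Q B X Y t * w (Y, r - t)\<bar>)"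
      by (rule integrable_abs[OF integrable_kernel_bounded[OF assms]])
    show "integrable lborel (\<lambda>Y. M * kernel Q B X Y t)"
      using has_bochner_integral_kernel[OF t] by (auto simp: has_bochner_integral_iff)
    show "\<bar>kernel Q B X Y t * w (Y, r - t)\<bar> \<le> M * kernel Q B X Y t" for Y
      using mult_left_mono[OF w(2)[of "(Y, r - t)"] kernel_nonneg[of Q B X Y t]]
      by (simp add: abs_mult kernel_nonneg mult.commute)
  qed
  also have "\<dots> = M"
    using has_bochner_integral_kernel[OF t] by (simp add: has_bochner_integral_iff)
  finally show ?thesis by (simp add: evol_semigroup_def)
qed

text \<open>Agreement at positive times is all that an integral over \<open>{0<..}\<close> can see;
  for other \<open>t\<close> the kernel formula is left uncontrolled.\<close>

lemma evol_semigroup_measurable_version: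
  assumes w[measurable]: "w \<in> borel_measurable borel"
  obtains F where "F \<in> borel_measurable borel" "\<And>t. t > 0 \<Longrightarrow> evol_semigroup Q B t w (X, r) = F t"
proof -
  obtain k where k[measurable]: "(\<lambda>p. k (fst p) (snd p)) \<in> borel_measurable (borel \<Otimes>\<^sub>M borel)"
    and eq: "\<And>t Y. t > 0 \<Longrightarrow> kernel Q B X Y t = k t Y"
    by (rule kernel_measurable_version[OF covK_inv, where X = X]) blast
  have w'[measurable]: "w \<in> borel_measurable (borel \<Otimes>\<^sub>M borel)"
    using w by (simp add: borel_prod)
  have "(\<lambda>p. k (fst p) (snd p) * w (snd p, r - fst p)) \<in> borel_measurable (borel \<Otimes>\<^sub>M lborel)"
    by measurable
  then have "(\<lambda>t. \<integral>Y. k t Y * w (Y, r - t) \<partial>lborel) \<in> borel_measurable borel"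
    by (intro lborel.borel_measurable_lebesgue_integral) (simp add: case_prod_beta')
  then show ?thesis
    by (rule that) (simp add: evol_semigroup_def eq)
qed

text \<open>The expansion is required at the single point \<open>(X, r)\<close>, so the lemma covers
  both \<open>u\<close>, with its gradient, and the square of \<open>u - u (X, r)\<close>, with
  \<open>D = 0\<close>.\<close>

lemma eventually_evol_semigroup_minus_id_le:
  fixes w :: "(real^'n) \<times> real \<Rightarrow> real"
  assumes w: "w \<in> borel_measurable borel" "\<And>z. \<bar>w z\<bar> \<le> M"
    and taylor: "\<And>h. \<bar>w ((X, r) + h) - w (X, r) - D \<bullet> h\<bar> \<le> C * (norm h)\<^sup>2" and C: "C \<ge> 0"
  shows "\<exists>C'. eventually (\<lambda>t. \<bar>evol_semigroup Q B t w (X, r) - w (X, r)\<bar> \<le> C' * t) (at_right 0)"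
proof -
  obtain C1 where C1: "eventually (\<lambda>t. norm (cov Q B t) \<le> C1 * t) (at_right 0)"
    using eventually_norm_cov_le by blast
  obtain C2 where C2: "eventually (\<lambda>t. norm (mat_exp (t *\<^sub>R B) *v X - X) \<le> C2 * t) (at_right 0)"
    using eventually_mat_exp_minus_id_le by blast
  define N where "N = 2 * (real CARD('n))\<^sup>2"
  \<comment> \<open>The bracket bounds the remainder: \<open>2 * N * C1\<close> for the spread about
    the mean, \<open>2 * C2\<^sup>2\<close> for the squared drift and \<open>1\<close> for
    \<open>t\<^sup>2\<close>, using \<open>t\<^sup>2 \<le> t\<close> for \<open>t < 1\<close>. The
    other two summands bound the linear term.\<close>
  define C' where "C' = C * (2 * N * C1 + 2 * C2\<^sup>2 + 1) + norm (fst D) * C2 + \<bar>snd D\<bar>"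
  have "eventually (\<lambda>t::real. 0 < t \<and> t < 1) (at_right 0)"
    unfolding eventually_at_right_field by (intro exI[of _ 1]) simp
  then have "eventually (\<lambda>t. \<bar>evol_semigroup Q B t w (X, r) - w (X, r)\<bar> \<le> C' * t) (at_right 0)"
    using C1 C2
  proof eventually_elim
    case (elim t)
    then have t: "t > 0" "t < 1" by auto
    define m where "m = mat_exp (t *\<^sub>R B) *v X"
    define k where "k Y = kernel Q B X Y t" for Y
    define h where "h Y = (Y - X, - t)" for Y
    have mX: "norm (m - X) \<le> C2 * t" using elim by (simp add: m_def)
    have k0: "k Y \<ge> 0" for Y by (simp add: k_def kernel_nonneg)
    obtain I where I: "has_bochner_integral lborel (\<lambda>Y. k Y * (norm (Y - m))\<^sup>2) I"
      and I_le: "I \<le> N * norm (cov Q B t)"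
      using has_bochner_integral_kernel_norm_square[OF t(1)] unfolding k_def m_def N_def by auto
    have k1: "has_bochner_integral lborel k 1"
      unfolding k_def by (rule has_bochner_integral_kernel[OF t(1)])
    have kinn: "has_bochner_integral lborel (\<lambda>Y. k Y * (fst D \<bullet> (Y - m))) 0"
      unfolding k_def m_def by (rule has_bochner_integral_kernel_inner[OF t(1)])
    \<comment> \<open>The linear term is split at the mean: the part in \<open>Y - m\<close>
      integrates to \<open>0\<close>, and what is left is a constant of order
      \<open>t\<close>.\<close>
    have "has_bochner_integral lborel (\<lambda>Y. k Y * (fst D \<bullet> (Y - m)) + k Y * (fst D \<bullet> (m - X) - snd D * t))
        (0 + 1 * (fst D \<bullet> (m - X) - snd D * t))"
      by (intro has_bochner_integral_add has_bochner_integral_mult_left kinn k1)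
    then have lin: "has_bochner_integral lborel (\<lambda>Y. k Y * (D \<bullet> h Y)) (fst D \<bullet> (m - X) - snd D * t)"
      by (simp add: h_def inner_prod_def algebra_simps inner_diff_right)
    have diff: "has_bochner_integral lborel (\<lambda>Y. k Y * (w (Y, r - t) - w (X, r)))
        (evol_semigroup Q B t w (X, r) - w (X, r))"
      unfolding has_bochner_integral_iff evol_semigroup_diff[OF t(1) w] k_def
      using integrable_kernel_bounded[OF t(1) w, of X "r - t"] has_bochner_integral_kernel[OF t(1), of X]
      by (simp add: has_bochner_integral_iff right_diff_distrib)
    have bd: "has_bochner_integral lborel
        (\<lambda>Y. C * (2 * (k Y * (norm (Y - m))\<^sup>2) + k Y * (2 * (norm (m - X))\<^sup>2 + t\<^sup>2)))
        (C * (2 * I + 1 * (2 * (norm (m - X))\<^sup>2 + t\<^sup>2)))"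
      by (intro has_bochner_integral_add has_bochner_integral_mult_left has_bochner_integral_mult_right I k1)
    let ?R = "\<lambda>Y. k Y * (w (Y, r - t) - w (X, r)) - k Y * (D \<bullet> h Y)"
    have R: "has_bochner_integral lborel ?R
        (evol_semigroup Q B t w (X, r) - w (X, r) - (fst D \<bullet> (m - X) - snd D * t))"
      by (intro has_bochner_integral_diff diff lin)
    have R_le: "\<bar>?R Y\<bar> \<le> C * (2 * (k Y * (norm (Y - m))\<^sup>2) + k Y * (2 * (norm (m - X))\<^sup>2 + t\<^sup>2))" for Y
    proof -
      have "norm (Y - X) \<le> norm (Y - m) + norm (m - X)"
        using norm_triangle_ineq[of "Y - m" "m - X"] by simp
      then have "(norm (Y - X))\<^sup>2 \<le> (norm (Y - m) + norm (m - X))\<^sup>2"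
        by (intro power_mono) auto
      also have "\<dots> \<le> 2 * (norm (Y - m))\<^sup>2 + 2 * (norm (m - X))\<^sup>2"
        using zero_le_power2[of "norm (Y - m) - norm (m - X)"] by (simp add: power2_eq_square algebra_simps)
      finally have h: "(norm (h Y))\<^sup>2 \<le> 2 * (norm (Y - m))\<^sup>2 + 2 * (norm (m - X))\<^sup>2 + t\<^sup>2"
        by (simp add: h_def norm_Pair)
      have "\<bar>?R Y\<bar> = k Y * \<bar>w ((X, r) + h Y) - w (X, r) - D \<bullet> h Y\<bar>"
        using k0[of Y] by (simp add: h_def abs_mult right_diff_distrib[symmetric])
      also have "\<dots> \<le> k Y * (C * (norm (h Y))\<^sup>2)"
        by (intro mult_left_mono taylor k0)
      also have "\<dots> \<le> k Y * (C * (2 * (norm (Y - m))\<^sup>2 + 2 * (norm (m - X))\<^sup>2 + t\<^sup>2))"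
        by (intro mult_left_mono h C k0)
      finally show ?thesis by (simp add: algebra_simps)
    qed
    have "\<bar>\<integral>Y. ?R Y \<partial>lborel\<bar> \<le> (\<integral>Y. C * (2 * (k Y * (norm (Y - m))\<^sup>2) + k Y * (2 * (norm (m - X))\<^sup>2 + t\<^sup>2)) \<partial>lborel)"
      using R bd R_le
      by (intro order_trans[OF integral_abs_bound] integral_mono) (auto simp: has_bochner_integral_iff)
    then have "\<bar>evol_semigroup Q B t w (X, r) - w (X, r) - (fst D \<bullet> (m - X) - snd D * t)\<bar>
        \<le> C * (2 * I + (2 * (norm (m - X))\<^sup>2 + t\<^sup>2))"
      using R bd by (simp only: has_bochner_integral_iff mult_1)
    also have "\<dots> \<le> C * (2 * (N * (C1 * t)) + (2 * (C2\<^sup>2 * t) + t))"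
    proof (intro mult_left_mono add_mono C)
      show "I \<le> N * (C1 * t)"
        using I_le elim by (auto simp: N_def intro: order_trans mult_left_mono)
      have tt: "t\<^sup>2 \<le> t" using t by (simp add: power2_eq_square mult_left_le)
      then show "t\<^sup>2 \<le> t" .
      have "(norm (m - X))\<^sup>2 \<le> (C2 * t)\<^sup>2" using mX by (intro power_mono) auto
      also have "\<dots> \<le> C2\<^sup>2 * t" using tt by (simp add: power_mult_distrib mult_left_mono)
      finally show "(norm (m - X))\<^sup>2 \<le> C2\<^sup>2 * t" .
    qed auto
    finally have 1: "\<bar>evol_semigroup Q B t w (X, r) - w (X, r) - (fst D \<bullet> (m - X) - snd D * t)\<bar>
        \<le> C * (2 * (N * (C1 * t)) + (2 * (C2\<^sup>2 * t) + t))" .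
    have "\<bar>fst D \<bullet> (m - X)\<bar> \<le> norm (fst D) * (C2 * t)"
      using Cauchy_Schwarz_ineq2[of "fst D" "m - X"] mult_left_mono[OF mX, of "norm (fst D)"] by simp
    moreover have "\<bar>snd D * t\<bar> = \<bar>snd D\<bar> * t" using t by (simp add: abs_mult)
    ultimately have "\<bar>evol_semigroup Q B t w (X, r) - w (X, r)\<bar> \<le>
        C * (2 * (N * (C1 * t)) + (2 * (C2\<^sup>2 * t) + t)) + norm (fst D) * (C2 * t) + \<bar>snd D\<bar> * t"
      using 1 by linarith
    also have "\<dots> = C' * t" by (simp add: C'_def algebra_simps)
    finally show ?case .
  qed
  then show ?thesis by blast
qed

end

section \<open>Integrals in time and their extended values\<close>

text \<open>Near \<open>0\<close> the integrand is at most a multiple of \<open>t powr - s\<close>,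
  integrable because \<open>s < 1\<close>; away from \<open>0\<close> it is at most a multiple of
  \<open>t powr (- 1 - s)\<close>, integrable at infinity because \<open>s > 0\<close>.
  \<open>F\<close> supplies measurability.\<close>

lemma set_integrable_powr_mult:
  fixes f :: "real \<Rightarrow> real"
  assumes s: "0 < s" "s < 1" and F: "F \<in> borel_measurable borel" "\<And>t. t > 0 \<Longrightarrow> f t = F t"
    and M: "\<And>t. t > 0 \<Longrightarrow> \<bar>f t\<bar> \<le> M" and C: "eventually (\<lambda>t. \<bar>f t\<bar> \<le> C * t) (at_right 0)"
  shows "set_integrable lborel {0<..} (\<lambda>t. t powr (- 1 - s) * f t)"
proof -
  obtain d where d: "d > 0" "\<And>t. 0 < t \<Longrightarrow> t < d \<Longrightarrow> \<bar>f t\<bar> \<le> C * t"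
    using C unfolding eventually_at_right_field by auto
  note [measurable] = F(1)
  \<comment> \<open>The facts on powers concern the gauge integral. Nonnegativity makes them
    absolute, and Borel measurability brings them from the completed measure to
    \<open>lborel\<close>.\<close>
  have lborelI: "set_integrable lborel A (\<lambda>t. t powr a)"
    if "(\<lambda>t. t powr a) integrable_on A" "A \<in> sets borel" for A and a :: real
  proof -
    have "(\<lambda>t. t powr a) absolutely_integrable_on A"
      using that by (intro nonnegative_absolutely_integrable_1) auto
    moreover have "(\<lambda>t. indicator A t *\<^sub>R t powr a) \<in> borel_measurable lborel"
      using that(2) by simp
    ultimately show ?thesis
      unfolding set_integrable_def using integrable_completion by blast
  qed
  have "set_integrable lborel {0<..<d} (\<lambda>t. t powr (- 1 - s) * F t)"
  proof (rule set_integrable_bound)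
    have "set_integrable lborel {0<..d} (\<lambda>t. t powr - s)"
      using s d by (intro lborelI integrable_on_powr_from_0') auto
    then have "set_integrable lborel {0<..<d} (\<lambda>t. t powr - s)"
      by (rule set_integrable_subset) auto
    then show "set_integrable lborel {0<..<d} (\<lambda>t. C * t powr - s)"
      by (rule set_integrable_mult_right)
    show "set_borel_measurable lborel {0<..<d} (\<lambda>t. t powr (- 1 - s) * F t)"
      unfolding set_borel_measurable_def by measurable
    show "AE t in lborel. t \<in> {0<..<d} \<longrightarrow> norm (t powr (- 1 - s) * F t) \<le> norm (C * t powr - s)"
    proof (intro AE_I2 impI)
      fix t assume t: "t \<in> {0<..<d}"
      then have "\<bar>F t\<bar> \<le> C * t" using d(2)[of t] F(2)[of t] by auto
      then have "t powr (- 1 - s) * \<bar>F t\<bar> \<le> t powr (- 1 - s) * (C * t)" by (intro mult_left_mono) auto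
      also have "\<dots> = C * (t powr (- 1 - s) * t powr 1)" using t by simp
      also have "\<dots> = C * t powr - s" by (simp only: powr_add[symmetric]) simp
      also have "\<dots> \<le> \<bar>C\<bar> * t powr - s" by (intro mult_right_mono) auto
      finally show "norm (t powr (- 1 - s) * F t) \<le> norm (C * t powr - s)" by (simp add: abs_mult)
    qed
  qed
  moreover have "set_integrable lborel {d..} (\<lambda>t. t powr (- 1 - s) * F t)"
  proof (rule set_integrable_bound)
    have "(\<lambda>t. t powr (- 1 - s)) integrable_on {d..}"
      by (rule has_integral_integrable[OF has_integral_powr_to_inf]) (use s d(1) in auto)
    then have "set_integrable lborel {d..} (\<lambda>t. t powr (- 1 - s))"
      by (rule lborelI) auto
    then show "set_integrable lborel {d..} (\<lambda>t. M * t powr (- 1 - s))"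
      by (rule set_integrable_mult_right)
    show "set_borel_measurable lborel {d..} (\<lambda>t. t powr (- 1 - s) * F t)"
      unfolding set_borel_measurable_def by measurable
    show "AE t in lborel. t \<in> {d..} \<longrightarrow> norm (t powr (- 1 - s) * F t) \<le> norm (M * t powr (- 1 - s))"
    proof (intro AE_I2 impI)
      fix t assume "t \<in> {d..}"
      then have "\<bar>F t\<bar> \<le> \<bar>M\<bar>" using d(1) M[of t] F(2)[of t] by auto
      then have "t powr (- 1 - s) * \<bar>F t\<bar> \<le> t powr (- 1 - s) * \<bar>M\<bar>" by (intro mult_left_mono) auto
      then show "norm (t powr (- 1 - s) * F t) \<le> norm (M * t powr (- 1 - s))"
        by (simp add: abs_mult mult.commute)
    qed
  qed
  ultimately have "set_integrable lborel ({0<..<d} \<union> {d..}) (\<lambda>t. t powr (- 1 - s) * F t)"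
    by (rule set_integrable_Un) auto
  also have "{0<..<d} \<union> {d..} = {0<..}" using d(1) by auto
  finally show ?thesis
    using F(2) by (subst set_integrable_cong[OF refl refl]) auto
qed

text \<open>Divergent integrals are included: the positive part grows, the negative part shrinks,
  and subtraction on \<open>ereal\<close> is monotone even with its value for
  \<open>\<infinity> - \<infinity>\<close>.\<close>

lemma ext_integral_mono:
  assumes "\<And>x. x \<in> A \<Longrightarrow> f x \<le> g x"
  shows "ext_integral A f \<le> ext_integral A g"
proof -
  have "(\<integral>\<^sup>+x\<in>A. ennreal (f x) \<partial>lborel) \<le> (\<integral>\<^sup>+x\<in>A. ennreal (g x) \<partial>lborel)"
    "(\<integral>\<^sup>+x\<in>A. ennreal (- g x) \<partial>lborel) \<le> (\<integral>\<^sup>+x\<in>A. ennreal (- f x) \<partial>lborel)"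
    using assms by (auto intro!: nn_integral_mono simp: indicator_def ennreal_leI)
  then show ?thesis
    unfolding ext_integral_def ereal_minus_le_minus
    by (intro ereal_minus_mono) (simp_all add: less_eq_ennreal.rep_eq)
qed

text \<open>The case \<open>x = \<infinity>\<close> is that of a divergent integral for
  \<open>\<phi> \<circ> u\<close>. The real lower bound rules out \<open>- \<infinity>\<close>,
  which the negative factor would turn into \<open>\<infinity>\<close>.\<close>

lemma ereal_uminus_mult_antimono:
  assumes "c \<ge> 0" "ereal a \<le> x"
  shows "ereal (- c) * x \<le> ereal (- c * a)"
  using assms by (cases x; cases "c = 0") (auto simp: mult_left_mono)

subsection \<open>Integrability in time and the convexity inequality\<close>

lemma schwartz_bounded_continuous:
  assumes "u \<in> schwartz"
  obtains M where "\<And>z. \<bar>u z\<bar> \<le> M" "continuous_on UNIV u"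
proof -
  obtain M where "\<forall>z. \<bar>u z\<bar> \<le> M"
    using schwartz_iter_partial(2)[OF assms, of "[]"] by auto
  moreover have "continuous_on UNIV u"
    using schwartz_iter_partial(1)[OF assms, of "[]"] by (simp add: differentiable_imp_continuous_on)
  ultimately show ?thesis using that by blast
qed

lemma continuous_comp_bounded:
  fixes u :: "'a \<Rightarrow> real" and \<phi> :: "real \<Rightarrow> real"
  assumes "continuous_on UNIV \<phi>" "\<And>z. \<bar>u z\<bar> \<le> M"
  obtains M' where "\<And>z. \<bar>\<phi> (u z)\<bar> \<le> M'"
proof -
  have "compact (\<phi> ` {-M..M})"
    using assms(1) by (intro compact_continuous_image) (auto intro: continuous_on_subset)
  then have "bounded (\<phi> ` {-M..M})" by (rule compact_imp_bounded)
  then obtain M' where "\<forall>y\<in>\<phi> ` {-M..M}. norm y \<le> M'" unfolding bounded_iff by blast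
  moreover have "u z \<in> {-M..M}" for z using assms(2)[of z] by auto
  ultimately have "\<bar>\<phi> (u z)\<bar> \<le> M'" for z by auto
  then show ?thesis by (rule that)
qed

lemma convex_on_C1_above_tangent:
  fixes \<phi> :: "real \<Rightarrow> real"
  assumes "convex_on UNIV \<phi>" "\<phi> C1_differentiable_on UNIV"
  shows "deriv \<phi> a * (x - a) \<le> \<phi> x - \<phi> a"
proof -
  have "\<phi> differentiable (at a)"
    using C1_diff_imp_diff[OF assms(2)] by (simp add: differentiable_on_def)
  then have "(\<phi> has_field_derivative deriv \<phi> a) (at a)"
    by (simp add: DERIV_deriv_iff_real_differentiable)
  then show ?thesis
    using convex_on_imp_above_tangent[OF assms(1), of a x "deriv \<phi> a"] by simp
qed

context
  fixes Q B :: "real^'n^'n" and s :: real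
  assumes Q_sym: "transpose Q = Q" and Q_nonneg: "\<forall>x. (Q *v x) \<bullet> x \<ge> 0"
    and covK_inv: "\<forall>t>0. invertible (covK Q B t)" and s: "0 < s" "s < 1"
begin

lemmas evol_rules = Q_sym Q_nonneg covK_inv

lemma set_integrable_evol_semigroup:
  fixes w :: "(real^'n) \<times> real \<Rightarrow> real"
  assumes w: "w \<in> borel_measurable borel" "\<And>z. \<bar>w z\<bar> \<le> M"
    and taylor: "\<And>h. \<bar>w ((X, r) + h) - w (X, r) - D \<bullet> h\<bar> \<le> C * (norm h)\<^sup>2" and C: "C \<ge> 0"
  shows "set_integrable lborel {0<..} (\<lambda>\<tau>. \<tau> powr (- 1 - s) * (evol_semigroup Q B \<tau> w (X, r) - w (X, r)))"
proof -
  obtain F where F: "F \<in> borel_measurable borel" "\<And>t. t > 0 \<Longrightarrow> evol_semigroup Q B t w (X, r) = F t"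
    by (rule evol_semigroup_measurable_version[OF evol_rules w(1), where X = X and r = r]) blast
  obtain C' where C': "eventually (\<lambda>t. \<bar>evol_semigroup Q B t w (X, r) - w (X, r)\<bar> \<le> C' * t) (at_right 0)"
    using eventually_evol_semigroup_minus_id_le[OF evol_rules assms] by blast
  show ?thesis
  proof (rule set_integrable_powr_mult[OF s _ _ _ C'])
    show "(\<lambda>t. F t - w (X, r)) \<in> borel_measurable borel" using F(1) by measurable
    show "evol_semigroup Q B t w (X, r) - w (X, r) = F t - w (X, r)" if "t > 0" for t
      using F(2)[OF that] by simp
    show "\<bar>evol_semigroup Q B t w (X, r) - w (X, r)\<bar> \<le> 2 * M" if "t > 0" for t
      using abs_evol_semigroup_le[OF evol_rules that w, of X r] w(2)[of "(X, r)"] by linarith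
  qed
qed

lemma set_integrable_evol_semigroup_schwartz:
  assumes u: "u \<in> schwartz"
  shows "set_integrable lborel {0<..} (\<lambda>\<tau>. \<tau> powr (- 1 - s) * (evol_semigroup Q B \<tau> u (X, r) - u (X, r)))"
proof -
  obtain M where M: "\<And>z. \<bar>u z\<bar> \<le> M" "continuous_on UNIV u" by (rule schwartz_bounded_continuous[OF u]) blast
  obtain D C where "\<And>h. \<bar>u ((X, r) + h) - u (X, r) - D \<bullet> h\<bar> \<le> C * (norm h)\<^sup>2" "C \<ge> 0"
    by (rule schwartz_taylor[OF u]) blast
  then show ?thesis
    using M by (intro set_integrable_evol_semigroup[of _ M _ _ D C]) (auto intro: borel_measurable_continuous_onI)
qed

text \<open>The square vanishes at the base point, and the Lipschitz bound on \<open>u\<close> makes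
  it at most \<open>C\<^sup>2 * (norm h)\<^sup>2\<close>: a Taylor expansion with zero
  gradient.\<close>

lemma set_integrable_evol_semigroup_schwartz_square:
  assumes u: "u \<in> schwartz"
  shows "set_integrable lborel {0<..} (\<lambda>\<tau>. \<tau> powr (- 1 - s) * evol_semigroup Q B \<tau> (\<lambda>z. (u z - u (X, r))\<^sup>2) (X, r))"
proof -
  let ?w = "\<lambda>z. (u z - u (X, r))\<^sup>2"
  obtain M where M: "\<And>z. \<bar>u z\<bar> \<le> M" "continuous_on UNIV u" by (rule schwartz_bounded_continuous[OF u]) blast
  have "\<exists>C. \<forall>x y. \<bar>u x - u y\<bar> \<le> C * norm (x - y)"
    using schwartz_iter_partial_lipschitz[OF u, of "[]"] by (simp only: iter_partial.simps list.set empty_subsetI)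
  then obtain C where C: "\<And>x y. \<bar>u x - u y\<bar> \<le> C * norm (x - y)" by blast
  have "set_integrable lborel {0<..} (\<lambda>\<tau>. \<tau> powr (- 1 - s) * (evol_semigroup Q B \<tau> ?w (X, r) - ?w (X, r)))"
  proof (rule set_integrable_evol_semigroup)
    show "?w \<in> borel_measurable borel"
      using M(2) by (intro borel_measurable_continuous_onI continuous_intros) auto
    show "\<bar>?w z\<bar> \<le> (2 * M)\<^sup>2" for z
    proof -
      have "\<bar>u z - u (X, r)\<bar> \<le> 2 * M" using M(1)[of z] M(1)[of "(X, r)"] by linarith
      then have "\<bar>u z - u (X, r)\<bar>\<^sup>2 \<le> (2 * M)\<^sup>2" by (intro power_mono) auto
      then show ?thesis by simp
    qed
    show "\<bar>?w ((X, r) + h) - ?w (X, r) - 0 \<bullet> h\<bar> \<le> C\<^sup>2 * (norm h)\<^sup>2" for h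
    proof -
      have "\<bar>u ((X, r) + h) - u (X, r)\<bar>\<^sup>2 \<le> (C * norm h)\<^sup>2"
        using C[of "(X, r) + h" "(X, r)"] by (intro power_mono) auto
      then show ?thesis by (simp add: power_mult_distrib)
    qed
  qed auto
  then show ?thesis by simp
qed

lemma evol_semigroup_square:
  assumes u: "u \<in> schwartz" and t: "t > 0"
  shows "evol_semigroup Q B t (\<lambda>z. (u z)\<^sup>2) (X, r) - (u (X, r))\<^sup>2 =
     2 * u (X, r) * (evol_semigroup Q B t u (X, r) - u (X, r)) +
     evol_semigroup Q B t (\<lambda>z. (u z - u (X, r))\<^sup>2) (X, r)"
proof -
  obtain M where M: "\<And>z. \<bar>u z\<bar> \<le> M" "continuous_on UNIV u" by (rule schwartz_bounded_continuous[OF u]) blast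
  have [measurable]: "u \<in> borel_measurable borel" using M(2) by (rule borel_measurable_continuous_onI)
  let ?a = "u (X, r)" and ?k = "\<lambda>Y. kernel Q B X Y t"
  have k: "has_bochner_integral lborel ?k 1"
    by (rule has_bochner_integral_kernel[OF evol_rules t])
  have 1: "has_bochner_integral lborel (\<lambda>Y. ?k Y * u (Y, r - t)) (evol_semigroup Q B t u (X, r))"
    using integrable_kernel_bounded[OF evol_rules t, of u M] M(1)
    by (simp add: has_bochner_integral_iff evol_semigroup_def)
  have "\<bar>(u z)\<^sup>2\<bar> \<le> M\<^sup>2" for z
    using power_mono[OF M(1)[of z], of 2] by simp
  then have 2: "has_bochner_integral lborel (\<lambda>Y. ?k Y * (u (Y, r - t))\<^sup>2) (evol_semigroup Q B t (\<lambda>z. (u z)\<^sup>2) (X, r))"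
    using integrable_kernel_bounded[OF evol_rules t, of "\<lambda>z. (u z)\<^sup>2" "M\<^sup>2"]
    by (simp add: has_bochner_integral_iff evol_semigroup_def)
  have "has_bochner_integral lborel (\<lambda>Y. ?k Y * (u (Y, r - t))\<^sup>2 - 2 * ?a * (?k Y * u (Y, r - t)) + ?a\<^sup>2 * ?k Y)
    (evol_semigroup Q B t (\<lambda>z. (u z)\<^sup>2) (X, r) - 2 * ?a * evol_semigroup Q B t u (X, r) + ?a\<^sup>2 * 1)"
    by (intro has_bochner_integral_add has_bochner_integral_diff has_bochner_integral_mult_right k 1 2)
  also have "(\<lambda>Y. ?k Y * (u (Y, r - t))\<^sup>2 - 2 * ?a * (?k Y * u (Y, r - t)) + ?a\<^sup>2 * ?k Y) =
    (\<lambda>Y. ?k Y * (u (Y, r - t) - ?a)\<^sup>2)"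
    by (simp add: fun_eq_iff power2_eq_square algebra_simps)
  finally have "evol_semigroup Q B t (\<lambda>z. (u z - ?a)\<^sup>2) (X, r) =
     evol_semigroup Q B t (\<lambda>z. (u z)\<^sup>2) (X, r) - 2 * ?a * evol_semigroup Q B t u (X, r) + ?a\<^sup>2 * 1"
    by (simp add: has_bochner_integral_iff evol_semigroup_def)
  then show ?thesis by (simp add: power2_eq_square algebra_simps)
qed

text \<open>At a fixed time all integrals converge, since \<open>\<phi>\<close> is bounded on the
  bounded range of \<open>u\<close>; only the later integration in time can diverge.\<close>

lemma evol_semigroup_convex_ge:
  assumes u: "u \<in> schwartz" and \<phi>: "convex_on UNIV \<phi>" "\<phi> C1_differentiable_on UNIV" and t: "t > 0"
  shows "deriv \<phi> (u (X, r)) * (evol_semigroup Q B t u (X, r) - u (X, r)) \<le>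
     evol_semigroup Q B t (\<phi> \<circ> u) (X, r) - (\<phi> \<circ> u) (X, r)"
proof -
  obtain M where M: "\<And>z. \<bar>u z\<bar> \<le> M" "continuous_on UNIV u" by (rule schwartz_bounded_continuous[OF u]) blast
  have c: "continuous_on UNIV \<phi>" by (rule C1_differentiable_imp_continuous_on[OF \<phi>(2)])
  obtain M' where M': "\<And>z. \<bar>\<phi> (u z)\<bar> \<le> M'" by (rule continuous_comp_bounded[OF c, of u M, OF M(1)]) blast
  have m: "u \<in> borel_measurable borel" "\<phi> \<circ> u \<in> borel_measurable borel"
    using M(2) c by (auto intro!: borel_measurable_continuous_onI continuous_on_compose intro: continuous_on_subset)
  let ?a = "u (X, r)" and ?k = "\<lambda>Y. kernel Q B X Y t"
  have k: "integrable lborel ?k"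
    using has_bochner_integral_kernel[OF evol_rules t] by (auto simp: has_bochner_integral_iff)
  have i: "integrable lborel (\<lambda>Y. ?k Y * (u (Y, r - t) - ?a))"
    "integrable lborel (\<lambda>Y. ?k Y * ((\<phi> \<circ> u) (Y, r - t) - (\<phi> \<circ> u) (X, r)))"
    using k integrable_kernel_bounded[OF evol_rules t m(1) M(1)] integrable_kernel_bounded[OF evol_rules t m(2), of M'] M'
    by (simp_all add: right_diff_distrib)
  have "deriv \<phi> ?a * (evol_semigroup Q B t u (X, r) - ?a) =
     (\<integral>Y. deriv \<phi> ?a * (?k Y * (u (Y, r - t) - ?a)) \<partial>lborel)"
    by (simp add: evol_semigroup_diff[OF evol_rules t m(1) M(1)])
  also have "\<dots> \<le> (\<integral>Y. ?k Y * ((\<phi> \<circ> u) (Y, r - t) - (\<phi> \<circ> u) (X, r)) \<partial>lborel)"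
  proof (rule integral_mono)
    show "deriv \<phi> ?a * (?k Y * (u (Y, r - t) - ?a)) \<le> ?k Y * ((\<phi> \<circ> u) (Y, r - t) - (\<phi> \<circ> u) (X, r))" for Y
      using mult_left_mono[OF convex_on_C1_above_tangent[OF \<phi>, of ?a "u (Y, r - t)"] kernel_nonneg, of Q B X Y t]
      by (simp add: mult_ac)
  qed (use i in auto)
  also have "\<dots> = evol_semigroup Q B t (\<phi> \<circ> u) (X, r) - (\<phi> \<circ> u) (X, r)"
    using M' by (intro evol_semigroup_diff[OF evol_rules t m(2), of M', symmetric]) simp
  finally show ?thesis .
qed

end

theorem proposition1p6:
  fixes Q B :: "real^'n^'n" and s :: real and u :: "(real^'n) \<times> real \<Rightarrow> real"
  assumes "CARD('n) \<ge> 2"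
    and "transpose Q = Q" and "\<forall>x. (Q *v x) \<bullet> x \<ge> 0"
    and "\<forall>t>0. invertible (covK Q B t)"
    and "0 < s" and "s < 1"
    and "u \<in> schwartz"
  shows
    "(\<forall>X t. \<bar>frac_power Q B s u (X, t)\<bar> \<noteq> \<infinity> \<and>
            \<bar>frac_power Q B s (\<lambda>z. (u z)\<^sup>2) (X, t)\<bar> \<noteq> \<infinity> \<and>
            \<bar>carre_du_champ Q B s u (X, t)\<bar> \<noteq> \<infinity> \<and>
            frac_power Q B s (\<lambda>z. (u z)\<^sup>2) (X, t) =
              ereal (2 * u (X, t)) * frac_power Q B s u (X, t) - 2 * carre_du_champ Q B s u (X, t))
     \<and>
     (\<forall>X t. frac_power Q B s (\<lambda>z. (u z)\<^sup>2) (X, t) \<le>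
              ereal (2 * u (X, t)) * frac_power Q B s u (X, t))
     \<and>
     (\<forall>\<phi> :: real \<Rightarrow> real. convex_on UNIV \<phi> \<and> \<phi> C1_differentiable_on UNIV \<longrightarrow>
        (\<forall>X t. frac_power Q B s (\<phi> \<circ> u) (X, t) < \<infinity> \<and>
               frac_power Q B s (\<phi> \<circ> u) (X, t) \<le>
                 ereal (deriv \<phi> (u (X, t))) * frac_power Q B s u (X, t)))"
proof (intro conjI allI impI)
  note A = assms(2-4)
  note s = assms(5,6) and u = assms(7)
  define c where "c = s / Gamma (1 - s)"
  have c: "c > 0"
    using s by (simp add: c_def)
  define U where "U X t = (LINT \<tau>:{0<..}|lborel. \<tau> powr (- 1 - s) * (evol_semigroup Q B \<tau> u (X, t) - u (X, t)))" for X t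
  define V where "V X t = (LINT \<tau>:{0<..}|lborel. \<tau> powr (- 1 - s) * evol_semigroup Q B \<tau> (\<lambda>z. (u z - u (X, t))\<^sup>2) (X, t))" for X t
  note intU = set_integrable_evol_semigroup_schwartz[OF A s u]
  note intV = set_integrable_evol_semigroup_schwartz_square[OF A s u]
  have U: "frac_power Q B s u (X, t) = ereal (- c * U X t)" for X t
    unfolding frac_power_def ext_integral_eq_set_lebesgue_integral[OF intU] U_def c_def by simp
  have V: "carre_du_champ Q B s u (X, t) = ereal (c / 2 * V X t)" for X t
  proof -
    have "(\<lambda>\<tau>. 1 / \<tau> powr (1 + s) * evol_semigroup Q B \<tau> (\<lambda>z. (u z - u (X, t))\<^sup>2) (X, t)) =
      (\<lambda>\<tau>. \<tau> powr (- 1 - s) * evol_semigroup Q B \<tau> (\<lambda>z. (u z - u (X, t))\<^sup>2) (X, t))"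
      using powr_minus_divide[of _ "1 + s"] by (simp add: fun_eq_iff)
    then show ?thesis
      by (simp add: carre_du_champ_def ext_integral_eq_set_lebesgue_integral[OF intV] V_def c_def)
  qed
  have V_nonneg: "V X t \<ge> 0" for X t
    unfolding V_def set_lebesgue_integral_def evol_semigroup_def
    by (intro integral_nonneg_AE AE_I2) (auto intro!: integral_nonneg_AE mult_nonneg_nonneg simp: kernel_nonneg)
  have W: "frac_power Q B s (\<lambda>z. (u z)\<^sup>2) (X, t) = ereal (- c * (2 * u (X, t) * U X t + V X t))" for X t
  proof -
    let ?g = "\<lambda>\<tau>. 2 * u (X, t) * (\<tau> powr (- 1 - s) * (evol_semigroup Q B \<tau> u (X, t) - u (X, t))) +
       \<tau> powr (- 1 - s) * evol_semigroup Q B \<tau> (\<lambda>z. (u z - u (X, t))\<^sup>2) (X, t)"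
    have eq: "\<tau> powr (- 1 - s) * (evol_semigroup Q B \<tau> (\<lambda>z. (u z)\<^sup>2) (X, t) - (u (X, t))\<^sup>2) = ?g \<tau>"
      if "\<tau> \<in> {0<..}" for \<tau>
      by (subst evol_semigroup_square[OF A s u]) (use that in \<open>simp_all add: algebra_simps\<close>)
    \<comment> \<open>Integrability for the square of \<open>u\<close> is obtained from the
      decomposition itself, not from an expansion of that function.\<close>
    have "set_integrable lborel {0<..} ?g"
      by (intro set_integral_add set_integrable_mult_right intU intV)
    then have "set_integrable lborel {0<..} (\<lambda>\<tau>. \<tau> powr (- 1 - s) * (evol_semigroup Q B \<tau> (\<lambda>z. (u z)\<^sup>2) (X, t) - (u (X, t))\<^sup>2))"
      using eq by (subst set_integrable_cong[OF refl refl eq])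
    then have "frac_power Q B s (\<lambda>z. (u z)\<^sup>2) (X, t) =
      ereal (- c * (LINT \<tau>:{0<..}|lborel. \<tau> powr (- 1 - s) * (evol_semigroup Q B \<tau> (\<lambda>z. (u z)\<^sup>2) (X, t) - (u (X, t))\<^sup>2)))"
      by (simp add: frac_power_def ext_integral_eq_set_lebesgue_integral c_def)
    also have "(LINT \<tau>:{0<..}|lborel. \<tau> powr (- 1 - s) * (evol_semigroup Q B \<tau> (\<lambda>z. (u z)\<^sup>2) (X, t) - (u (X, t))\<^sup>2)) =
      (LINT \<tau>:{0<..}|lborel. ?g \<tau>)"
      using eq by (intro set_lebesgue_integral_cong) auto
    also have "\<dots> = 2 * u (X, t) * U X t + V X t"
      unfolding U_def V_def
      by (subst set_integral_add(2)) (auto intro!: set_integrable_mult_right intU intV simp: set_integral_mult_right)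
    finally show ?thesis .
  qed
  fix X t
  show "\<bar>frac_power Q B s u (X, t)\<bar> \<noteq> \<infinity>" "\<bar>frac_power Q B s (\<lambda>z. (u z)\<^sup>2) (X, t)\<bar> \<noteq> \<infinity>"
    "\<bar>carre_du_champ Q B s u (X, t)\<bar> \<noteq> \<infinity>"
    by (simp_all add: U V W)
  have two: "2 * ereal x = ereal (2 * x)" for x
    by (metis numeral_eq_ereal times_ereal.simps(1))
  show "frac_power Q B s (\<lambda>z. (u z)\<^sup>2) (X, t) =
      ereal (2 * u (X, t)) * frac_power Q B s u (X, t) - 2 * carre_du_champ Q B s u (X, t)"
    by (simp add: U V W two algebra_simps)
  show "frac_power Q B s (\<lambda>z. (u z)\<^sup>2) (X, t) \<le> ereal (2 * u (X, t)) * frac_power Q B s u (X, t)"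
    using mult_nonneg_nonneg[OF less_imp_le[OF c] V_nonneg[of X t]] by (simp add: U W algebra_simps)
  fix \<phi> :: "real \<Rightarrow> real" assume \<phi>: "convex_on UNIV \<phi> \<and> \<phi> C1_differentiable_on UNIV"
  let ?d = "deriv \<phi> (u (X, t))"
  have "set_integrable lborel {0<..} (\<lambda>\<tau>. ?d * (\<tau> powr (- 1 - s) * (evol_semigroup Q B \<tau> u (X, t) - u (X, t))))"
    by (intro set_integrable_mult_right intU)
  \<comment> \<open>The tangent side is integrable, so its extended integral is a real number; this
    is the finite lower bound for the integral of \<open>\<phi> \<circ> u\<close>.\<close>
  then have "ereal (?d * U X t) = ext_integral {0<..} (\<lambda>\<tau>. ?d * (\<tau> powr (- 1 - s) * (evol_semigroup Q B \<tau> u (X, t) - u (X, t))))"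
    by (simp add: ext_integral_eq_set_lebesgue_integral U_def)
  also have "\<dots> \<le> ext_integral {0<..} (\<lambda>\<tau>. \<tau> powr (- 1 - s) * (evol_semigroup Q B \<tau> (\<phi> \<circ> u) (X, t) - (\<phi> \<circ> u) (X, t)))"
  proof (rule ext_integral_mono)
    fix \<tau> :: real assume "\<tau> \<in> {0<..}"
    then have "?d * (evol_semigroup Q B \<tau> u (X, t) - u (X, t)) \<le> evol_semigroup Q B \<tau> (\<phi> \<circ> u) (X, t) - (\<phi> \<circ> u) (X, t)"
      using evol_semigroup_convex_ge[OF A s u] \<phi> by simp
    from mult_left_mono[OF this, of "\<tau> powr (- 1 - s)"]
    show "?d * (\<tau> powr (- 1 - s) * (evol_semigroup Q B \<tau> u (X, t) - u (X, t))) \<le>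
        \<tau> powr (- 1 - s) * (evol_semigroup Q B \<tau> (\<phi> \<circ> u) (X, t) - (\<phi> \<circ> u) (X, t))"
      by (simp add: mult_ac)
  qed
  finally have le: "frac_power Q B s (\<phi> \<circ> u) (X, t) \<le> ereal (- c * (?d * U X t))"
    unfolding frac_power_def c_def[symmetric] using c by (intro ereal_uminus_mult_antimono) auto
  then show "frac_power Q B s (\<phi> \<circ> u) (X, t) \<le> ereal ?d * frac_power Q B s u (X, t)"
    by (simp add: U mult_ac)
  \<comment> \<open>The upper bound is real, so only \<open>- \<infinity>\<close> remains possible
    as an infinite value.\<close>
  from le show "frac_power Q B s (\<phi> \<circ> u) (X, t) < \<infinity>"
    by (auto simp: less_top[symmetric])
qed

end
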